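(* Let $(BC,D)$ be an A$_\infty$ coalgebra over a field $\Bbbk$ and let $F:(B^MC,D^M)\to(B^NC,D^N)$ be an A$_\infty$ cobimodule map whose lowest component $F_{0,0}:M\to N$ induces an isomorphism $(F_{0,0})_*:H_\bullet(M,D^M_{0,0})\to H_\bullet(N,D^N_{0,0})$. Then there exists an A$_\infty$ cobimodule map $G:(B^NC,D^N)\to(B^MC,D^M)$ such that on homology $G_*\circ F_*=\mathrm{id}_{H_\bullet(B^MC,D^M)}$ and $F_*\circ G_*=\mathrm{id}_{H_\bullet(B^NC,D^N)}$.
   Context: For a graded $\Bbbk$-module $C$, $sC$ denotes its suspension and $BC=\prod_{i\ge 0}(sC)^{\otimes i}$. An A$_\infty$ coalgebra structure on $C$ is a derivation $D$ of $BC$ of degree $+1$ with $D^2=0$. For a graded module $M$, $B^MC=\prod_{i,j\ge0}(sC)^{\otimes i}\otimes sM\otimes (sC)^{\otimes j}$. An A$_\infty$ cobimodule structure on $M$ is a degree $+1$ map $D^M$ on $B^MC$ which is a derivation over $D$ with $(D^M)^2=0$; it is determined by its restriction to $sM$, whose component into $(sC)^{\otimes i}\otimes sM\otimes(sC)^{\otimes j}$ is $D^M_{i,j}$ (so $D^M_{0,0}$ is a differential on $M$). An A$_\infty$ cobimodule map $F:(B^MC,D^M)\to(B^NC,D^N)$ is a degree-$0$ $BC$-bimodule map with $D^N F=F D^M$; it is determined by $F|_M$, whose component into $(sC)^{\otimes i}\otimes sN\otimes(sC)^{\otimes j}$ is $F_{i,j}$. $F_*$ denotes the induced map on homology of the complexes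 $(B^MC,D^M)\to(B^NC,D^N)$. *)

theory Defs
  imports Main
begin

text \<open>
  Encoding. Over a field every graded module has a homogeneous basis, so a graded
  module C is given by a basis type 'c together with the degree function degc,
  where degc c is the degree of the suspended basis element s c in sC.
  Elements of BC = prod_i (sC)^{\<otimes>i} are functions from words ('c list) to
  scalars with finite support in each tensor length; elements of
  B^M C = prod_{i,j} (sC)^{\<otimes>i} \<otimes> sM \<otimes> (sC)^{\<otimes>j} are functions on
  triples (u, m, v) with finite support for each pair of lengths (i, j).
  Structure maps are given by their restrictions to generators (as in the paper,
  a derivation / bimodule map is determined by its restriction), and extended by
  the (continuous) derivation / bimodule-map rules with Koszul signs.
\<close>

definition ksign :: "int \<Rightarrow> 'k::field" where
  "ksign e = (if even e then 1 else -1)"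

definition wdeg :: "('c \<Rightarrow> int) \<Rightarrow> 'c list \<Rightarrow> int" where
  "wdeg degc w = sum_list (map degc w)"

definition tdeg :: "('c \<Rightarrow> int) \<Rightarrow> ('m \<Rightarrow> int) \<Rightarrow> ('c list \<times> 'm \<times> 'c list) \<Rightarrow> int" where
  "tdeg degc degm t = (case t of (u, m, v) \<Rightarrow> wdeg degc u + degm m + wdeg degc v)"

definition homog :: "('a \<Rightarrow> int) \<Rightarrow> int \<Rightarrow> ('a \<Rightarrow> 'k::zero) \<Rightarrow> bool" where
  "homog deg n x = (\<forall>a. x a \<noteq> 0 \<longrightarrow> deg a = n)"

definition adm_B :: "('c list \<Rightarrow> 'k::zero) \<Rightarrow> bool" where
  "adm_B x = (\<forall>n. finite {w. length w = n \<and> x w \<noteq> 0})"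

definition adm_BM :: "('c list \<times> 'm \<times> 'c list \<Rightarrow> 'k::zero) \<Rightarrow> bool" where
  "adm_BM x = (\<forall>i j. finite {(u, m, v). length u = i \<and> length v = j \<and> x (u, m, v) \<noteq> 0})"

definition fin_supp :: "('a \<Rightarrow> 'k::zero) \<Rightarrow> bool" where
  "fin_supp x = finite {a. x a \<noteq> 0}"

text \<open>The derivation D of BC determined by d (its restriction to sC).\<close>
definition Dext :: "('c \<Rightarrow> int) \<Rightarrow> ('c \<Rightarrow> 'c list \<Rightarrow> 'k::field)
    \<Rightarrow> ('c list \<Rightarrow> 'k) \<Rightarrow> ('c list \<Rightarrow> 'k)" where
  "Dext degc d x w' =
     (\<Sum>(u, v, z) \<in> {(u, v, z). u @ v @ z = w'}.
        \<Sum>c \<in> {c. x (u @ [c] @ z) \<noteq> 0}.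
          ksign (wdeg degc u) * x (u @ [c] @ z) * d c v)"

text \<open>A(n uncurved) A-infinity coalgebra structure: components D_i : sC \<rightarrow> (sC)^{\<otimes>i},
  i \<ge> 1, of degree +1, with D^2 = 0.\<close>
definition ainf_coalg :: "('c \<Rightarrow> int) \<Rightarrow> ('c \<Rightarrow> 'c list \<Rightarrow> 'k::field) \<Rightarrow> bool" where
  "ainf_coalg degc d =
     ((\<forall>c. adm_B (d c) \<and> homog (wdeg degc) (degc c + 1) (d c) \<and> d c [] = 0) \<and>
      (\<forall>x. adm_B x \<longrightarrow> Dext degc d (Dext degc d x) = (\<lambda>_. 0)))"

text \<open>The map D^M on B^M C determined by dM (its restriction to sM), a derivation over D.\<close>
definition DMext :: "('c \<Rightarrow> int) \<Rightarrow> ('m \<Rightarrow> int) \<Rightarrow> ('c \<Rightarrow> 'c list \<Rightarrow> 'k::field)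
    \<Rightarrow> ('m \<Rightarrow> ('c list \<times> 'm \<times> 'c list) \<Rightarrow> 'k)
    \<Rightarrow> (('c list \<times> 'm \<times> 'c list) \<Rightarrow> 'k) \<Rightarrow> (('c list \<times> 'm \<times> 'c list) \<Rightarrow> 'k)" where
  "DMext degc degm d dM x t =
    (case t of (u', m', v') \<Rightarrow>
      (\<Sum>(u, v, z) \<in> {(u, v, z). u @ v @ z = u'}.
        \<Sum>c \<in> {c. x (u @ [c] @ z, m', v') \<noteq> 0}.
          ksign (wdeg degc u) * x (u @ [c] @ z, m', v') * d c v)
    + (\<Sum>(u, p) \<in> {(u, p). u @ p = u'}. \<Sum>(q, z) \<in> {(q, z). q @ z = v'}.
        \<Sum>m \<in> {m. x (u, m, z) \<noteq> 0}.
          ksign (wdeg degc u) * x (u, m, z) * dM m (p, m', q))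
    + (\<Sum>(u, v, z) \<in> {(u, v, z). u @ v @ z = v'}.
        \<Sum>c \<in> {c. x (u', m', u @ [c] @ z) \<noteq> 0}.
          ksign (wdeg degc u' + degm m' + wdeg degc u) * x (u', m', u @ [c] @ z) * d c v))"

definition ainf_cobimod :: "('c \<Rightarrow> int) \<Rightarrow> ('m \<Rightarrow> int) \<Rightarrow> ('c \<Rightarrow> 'c list \<Rightarrow> 'k::field)
    \<Rightarrow> ('m \<Rightarrow> ('c list \<times> 'm \<times> 'c list) \<Rightarrow> 'k) \<Rightarrow> bool" where
  "ainf_cobimod degc degm d dM =
     ((\<forall>m. adm_BM (dM m) \<and> homog (tdeg degc degm) (degm m + 1) (dM m)) \<and>
      (\<forall>x. adm_BM x \<longrightarrow> DMext degc degm d dM (DMext degc degm d dM x) = (\<lambda>_. 0)))"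

text \<open>The BC-bimodule map B^M C \<rightarrow> B^N C determined by f (its restriction to sM).\<close>
definition Fext :: "('m \<Rightarrow> ('c list \<times> 'n \<times> 'c list) \<Rightarrow> 'k::field)
    \<Rightarrow> (('c list \<times> 'm \<times> 'c list) \<Rightarrow> 'k) \<Rightarrow> (('c list \<times> 'n \<times> 'c list) \<Rightarrow> 'k)" where
  "Fext f x t =
    (case t of (u', n', v') \<Rightarrow>
      (\<Sum>(u, p) \<in> {(u, p). u @ p = u'}. \<Sum>(q, z) \<in> {(q, z). q @ z = v'}.
        \<Sum>m \<in> {m. x (u, m, z) \<noteq> 0}. x (u, m, z) * f m (p, n', q)))"

definition cobimod_map :: "('c \<Rightarrow> int) \<Rightarrow> ('m \<Rightarrow> int) \<Rightarrow> ('n \<Rightarrow> int)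
    \<Rightarrow> ('c \<Rightarrow> 'c list \<Rightarrow> 'k::field)
    \<Rightarrow> ('m \<Rightarrow> ('c list \<times> 'm \<times> 'c list) \<Rightarrow> 'k)
    \<Rightarrow> ('n \<Rightarrow> ('c list \<times> 'n \<times> 'c list) \<Rightarrow> 'k)
    \<Rightarrow> ('m \<Rightarrow> ('c list \<times> 'n \<times> 'c list) \<Rightarrow> 'k) \<Rightarrow> bool" where
  "cobimod_map degc degm degn d dM dN f =
     ((\<forall>m. adm_BM (f m) \<and> homog (tdeg degc degn) (degm m) (f m)) \<and>
      (\<forall>x. adm_BM x \<longrightarrow> DMext degc degn d dN (Fext f x) = Fext f (DMext degc degm d dM x)))"

definition comp00 :: "('m \<Rightarrow> ('c list \<times> 'n \<times> 'c list) \<Rightarrow> 'k::field)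
    \<Rightarrow> ('m \<Rightarrow> 'k) \<Rightarrow> ('n \<Rightarrow> 'k)" where
  "comp00 f x n' = (\<Sum>m \<in> {m. x m \<noteq> 0}. x m * f m ([], n', []))"

definition cycles :: "(('a \<Rightarrow> 'k) \<Rightarrow> bool) \<Rightarrow> ('a \<Rightarrow> int) \<Rightarrow> (('a \<Rightarrow> 'k) \<Rightarrow> ('a \<Rightarrow> 'k::field))
    \<Rightarrow> int \<Rightarrow> ('a \<Rightarrow> 'k) set" where
  "cycles A deg d n = {x. A x \<and> homog deg n x \<and> d x = (\<lambda>_. 0)}"

definition bdries :: "(('a \<Rightarrow> 'k) \<Rightarrow> bool) \<Rightarrow> ('a \<Rightarrow> int) \<Rightarrow> (('a \<Rightarrow> 'k) \<Rightarrow> ('a \<Rightarrow> 'k::field))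
    \<Rightarrow> int \<Rightarrow> ('a \<Rightarrow> 'k) set" where
  "bdries A deg d n = {d y | y. A y \<and> homog deg (n - 1) y}"

definition induces_hom_iso where
  "induces_hom_iso A1 deg1 d1 A2 deg2 d2 f =
     ((\<forall>n. \<forall>x \<in> cycles A1 deg1 d1 n. f x \<in> bdries A2 deg2 d2 n \<longrightarrow> x \<in> bdries A1 deg1 d1 n) \<and>
      (\<forall>n. \<forall>y \<in> cycles A2 deg2 d2 n. \<exists>x \<in> cycles A1 deg1 d1 n. (\<lambda>a. f x a - y a) \<in> bdries A2 deg2 d2 n))"

definition hom_comp_id where
  "hom_comp_id A deg d g f =
     (\<forall>n. \<forall>x \<in> cycles A deg d n. (\<lambda>a. g (f x) a - x a) \<in> bdries A deg d n)"

end

theory Submission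
  imports Defs "HOL.Vector_Spaces" "HOL-Library.Function_Algebras" "HOL-Library.Groups_Big_Fun"
begin

text \<open>
  The mapping cone \<open>K\<close> of \<open>F\<close>, shifted \<open>M\<close> plus \<open>N\<close>, is again an A-infinity cobimodule, and its
  lowest component is the cone of \<open>F\<^sub>0\<^sub>0\<close>, an acyclic complex of vector spaces, hence one with a
  contraction \<open>h\<close>. The diagonal bimodule map \<open>T = \<plusminus> 1 \<otimes> h \<otimes> 1\<close> need not contract \<open>B\<^sup>K C\<close>, but
  \<open>U = D T + T D\<close> is a bimodule map that differs from the identity only by terms of larger word
  length. Such a map is invertible, because elements of \<open>B\<^sup>K C\<close> are arbitrary products over word
  lengths, and \<open>T U\<^sup>-\<^sup>1\<close> contracts \<open>B\<^sup>K C\<close>. Its component from \<open>N\<close> to \<open>M\<close> is the map \<open>G\<close>, and its two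
  diagonal components are the homotopies showing that \<open>G\<close> inverts \<open>F\<close>.
\<close>

section \<open>Locally finite functions and filtered matrices\<close>

definition scale_fun :: "'k::field \<Rightarrow> ('a \<Rightarrow> 'k) \<Rightarrow> 'a \<Rightarrow> 'k" (infixr "*\<^sub>f" 75)
  where "c *\<^sub>f x = (\<lambda>a. c * x a)"

lemma scale_fun_apply [simp]: "(c *\<^sub>f x) a = c * x a"
  by (simp add: scale_fun_def)

interpretation fun_space: vector_space scale_fun
  by unfold_locales (auto simp: fun_eq_iff algebra_simps)

interpretation fun_space: vector_space_pair scale_fun scale_fun ..

definition basis_vec :: "'a \<Rightarrow> 'a \<Rightarrow> 'k::field"
  where "basis_vec a = (\<lambda>b. if b = a then 1 else 0)"

definition lin_ext :: "('a \<Rightarrow> 'b \<Rightarrow> 'k::field) \<Rightarrow> ('a \<Rightarrow> 'k) \<Rightarrow> 'b \<Rightarrow> 'k"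
  where "lin_ext K x = (\<lambda>b. \<Sum>a. x a * K a b)"

definition locally_finite :: "('a \<Rightarrow> nat) \<Rightarrow> ('a \<Rightarrow> 'k::zero) \<Rightarrow> bool"
  where "locally_finite wt x \<longleftrightarrow> (\<forall>n. finite {a. wt a \<le> n \<and> x a \<noteq> 0})"

definition filtered_mat :: "('a \<Rightarrow> nat) \<Rightarrow> ('b \<Rightarrow> nat) \<Rightarrow> ('a \<Rightarrow> 'b \<Rightarrow> 'k::zero) \<Rightarrow> bool"
  where "filtered_mat wt wt' K \<longleftrightarrow>
    (\<forall>a. locally_finite wt' (K a)) \<and> (\<forall>a b. K a b \<noteq> 0 \<longrightarrow> wt a \<le> wt' b)"

lemma sum_fun_apply: "(\<Sum>i\<in>I. f i) a = (\<Sum>i\<in>I. f i a)"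
  by (induction I rule: infinite_finite_induct) simp_all

lemma Sum_any_reindex_inj:
  assumes "inj e" "\<And>a. g a \<noteq> 0 \<Longrightarrow> a \<in> range e"
  shows "(\<Sum>a. g a) = (\<Sum>j. g (e j))"
proof -
  have "{a. g a \<noteq> 0} = e ` {j. g (e j) \<noteq> 0}"
    using assms(2) by auto
  then show ?thesis
    by (simp add: Sum_any.expand_set sum.reindex [OF inj_on_subset [OF assms(1) subset_UNIV]])
qed

lemma lin_ext_apply: "lin_ext K x b = (\<Sum>a. x a * K a b)"
  by (simp add: lin_ext_def)

lemma lin_ext_nonzeroE:
  assumes "lin_ext K x b \<noteq> 0"
  obtains a where "x a \<noteq> 0" "K a b \<noteq> 0"
  using Sum_any.not_neutral_obtains_not_neutral [OF assms [unfolded lin_ext_apply]] by auto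

lemma locally_finite_subset:
  assumes "locally_finite wt y" "\<And>a. x a \<noteq> 0 \<Longrightarrow> y a \<noteq> 0"
  shows "locally_finite wt x"
proof -
  have "{a. wt a \<le> n \<and> x a \<noteq> 0} \<subseteq> {a. wt a \<le> n \<and> y a \<noteq> 0}" for n
    using assms(2) by auto
  then show ?thesis
    using assms(1) unfolding locally_finite_def by (meson finite_subset)
qed

lemma locally_finite_slice:
  assumes "locally_finite wt x" "inj e" "\<And>j. wt (e j) \<le> wt' j + n"
  shows "locally_finite wt' (\<lambda>j. x (e j))"
  unfolding locally_finite_def
proof
  fix k
  have "finite (e -` {a. wt a \<le> k + n \<and> x a \<noteq> 0})"
    using assms(1) by (intro finite_vimageI assms(2)) (simp add: locally_finite_def)
  moreover have "{j. wt' j \<le> k \<and> x (e j) \<noteq> 0} \<subseteq> e -` {a. wt a \<le> k + n \<and> x a \<noteq> 0}"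
    by (auto intro!: order_trans [OF assms(3)])
  ultimately show "finite {j. wt' j \<le> k \<and> x (e j) \<noteq> 0}"
    by (rule rev_finite_subset)
qed

lemma locally_finite_zero [simp]: "locally_finite wt 0"
  by (simp add: locally_finite_def)

lemma locally_finite_basis_vec [simp]: "locally_finite wt (basis_vec a)"
  by (simp add: locally_finite_def basis_vec_def)

lemma locally_finite_add:
  fixes x y :: "'a \<Rightarrow> 'k::field"
  assumes "locally_finite wt x" "locally_finite wt y"
  shows "locally_finite wt (x + y)"
  unfolding locally_finite_def
proof
  fix n
  have "{a. wt a \<le> n \<and> (x + y) a \<noteq> 0} \<subseteq> {a. wt a \<le> n \<and> x a \<noteq> 0} \<union> {a. wt a \<le> n \<and> y a \<noteq> 0}"
    by auto
  then show "finite {a. wt a \<le> n \<and> (x + y) a \<noteq> 0}"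
    by (rule finite_subset) (use assms in \<open>auto simp: locally_finite_def\<close>)
qed

lemma locally_finite_scale: "locally_finite wt x \<Longrightarrow> locally_finite wt (c *\<^sub>f x)"
  by (erule locally_finite_subset) auto

lemma locally_finite_uminus: "locally_finite wt x \<Longrightarrow> locally_finite wt (- x :: 'a \<Rightarrow> 'k::field)"
  by (erule locally_finite_subset) auto

lemma locally_finite_diff:
  "locally_finite wt x \<Longrightarrow> locally_finite wt y \<Longrightarrow> locally_finite wt (x - y :: 'a \<Rightarrow> 'k::field)"
  using locally_finite_add [of wt x "- y"] by (simp add: locally_finite_uminus)

lemma filtered_mat_row: "filtered_mat wt wt' K \<Longrightarrow> locally_finite wt' (K a)"
  by (simp add: filtered_mat_def)

lemma filtered_mat_le: "filtered_mat wt wt' K \<Longrightarrow> K a b \<noteq> 0 \<Longrightarrow> wt a \<le> wt' b"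
  by (auto simp: filtered_mat_def)

lemma filtered_mat_add:
  "filtered_mat wt wt' K \<Longrightarrow> filtered_mat wt wt' L \<Longrightarrow> filtered_mat wt wt' (K + L :: 'a \<Rightarrow> 'b \<Rightarrow> 'k::field)"
  by (simp add: filtered_mat_def locally_finite_add) (metis add_0)

lemma filtered_basis_vec: "filtered_mat wt wt basis_vec"
  by (simp add: filtered_mat_def) (simp add: basis_vec_def)

lemma filtered_mat_basis_vec_image:
  "(\<And>a. wt a \<le> wt' (g a)) \<Longrightarrow> filtered_mat wt wt' (\<lambda>a. basis_vec (g a))"
  by (simp add: filtered_mat_def) (simp add: basis_vec_def)

lemma finite_lin_ext_support:
  assumes "locally_finite wt x" "filtered_mat wt wt' K"
  shows "finite {a. x a \<noteq> 0 \<and> K a b \<noteq> 0}"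
proof (rule finite_subset)
  show "{a. x a \<noteq> 0 \<and> K a b \<noteq> 0} \<subseteq> {a. wt a \<le> wt' b \<and> x a \<noteq> 0}"
    using assms(2) by (auto simp: filtered_mat_def)
  show "finite {a. wt a \<le> wt' b \<and> x a \<noteq> 0}"
    using assms(1) by (simp add: locally_finite_def)
qed

lemma locally_finite_lin_ext:
  assumes x: "locally_finite wt x" and K: "filtered_mat wt wt' K"
  shows "locally_finite wt' (lin_ext K x)"
  unfolding locally_finite_def
proof
  fix n
  have "\<exists>a. wt a \<le> n \<and> x a \<noteq> 0 \<and> K a b \<noteq> 0" if "wt' b \<le> n" "lin_ext K x b \<noteq> 0" for b
    using that(2) by (rule lin_ext_nonzeroE) (use that(1) filtered_mat_le [OF K] order_trans in blast)
  then have "{b. wt' b \<le> n \<and> lin_ext K x b \<noteq> 0}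
      \<subseteq> (\<Union>a \<in> {a. wt a \<le> n \<and> x a \<noteq> 0}. {b. wt' b \<le> n \<and> K a b \<noteq> 0})"
    by auto
  moreover have "finite (\<Union>a \<in> {a. wt a \<le> n \<and> x a \<noteq> 0}. {b. wt' b \<le> n \<and> K a b \<noteq> 0})"
    using x filtered_mat_row [OF K] by (auto simp: locally_finite_def)
  ultimately show "finite {b. wt' b \<le> n \<and> lin_ext K x b \<noteq> 0}"
    by (rule finite_subset)
qed

lemma lin_ext_zero [simp]: "lin_ext K 0 = 0"
  by (auto simp: lin_ext_apply)

lemma lin_ext_basis_vec [simp]: "lin_ext K (basis_vec a) = K a"
proof
  fix b
  have "basis_vec a c * K c b = (if c = a then K c b else 0)" for c
    by (simp add: basis_vec_def)
  then show "lin_ext K (basis_vec a) b = K a b"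
    unfolding lin_ext_apply by simp
qed

lemma lin_ext_identity [simp]: "lin_ext basis_vec x = x"
proof
  fix b
  have "x a * basis_vec a b = (if a = b then x a else 0)" for a
    by (simp add: basis_vec_def)
  then show "lin_ext basis_vec x b = x b"
    unfolding lin_ext_apply by simp
qed

lemma lin_ext_comp_basis_vec [simp]: "lin_ext K \<circ> basis_vec = K"
  by (auto simp: fun_eq_iff)

lemma lin_ext_basis_vec_comp [simp]: "lin_ext basis_vec \<circ> K = K"
  by (auto simp: fun_eq_iff)

lemma lin_ext_add:
  assumes "locally_finite wt x" "locally_finite wt y" "filtered_mat wt wt' K"
  shows "lin_ext K (x + y) = lin_ext K x + lin_ext K y"
  using assms by (intro ext)
    (simp add: lin_ext_apply distrib_right Sum_any.distrib finite_lin_ext_support)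

lemma lin_ext_scale: "lin_ext K (c *\<^sub>f x) = c *\<^sub>f lin_ext K x"
proof (cases "c = 0")
  case False
  then show ?thesis
    by (intro ext) (simp add: lin_ext_apply Sum_any.expand_set sum_distrib_left mult.assoc)
qed (auto simp: lin_ext_apply)

lemma lin_ext_uminus: "lin_ext K (- x) = - lin_ext K x"
  using lin_ext_scale [of K "-1" x] by simp

lemma lin_ext_diff:
  assumes "locally_finite wt x" "locally_finite wt y" "filtered_mat wt wt' K"
  shows "lin_ext K (x - y) = lin_ext K x - lin_ext K y"
  using lin_ext_add [OF assms(1) locally_finite_uminus [OF assms(2)] assms(3)]
  by (simp add: lin_ext_uminus)

lemma lin_ext_add_mat:
  assumes "locally_finite wt x" "filtered_mat wt wt' K" "filtered_mat wt wt' L"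
  shows "lin_ext (K + L) x = lin_ext K x + lin_ext L x"
  using assms by (intro ext)
    (simp add: lin_ext_apply distrib_left Sum_any.distrib finite_lin_ext_support)

lemma lin_ext_scale_mat: "lin_ext (\<lambda>a. c *\<^sub>f K a) x = c *\<^sub>f lin_ext K x"
proof -
  have "lin_ext (\<lambda>a. c *\<^sub>f K a) x = lin_ext K (c *\<^sub>f x)"
    by (intro ext) (simp add: lin_ext_apply mult_ac)
  then show ?thesis by (simp add: lin_ext_scale)
qed

lemma lin_ext_comp:
  assumes x: "locally_finite wt x" and K: "filtered_mat wt wt' K" and L: "filtered_mat wt' wt'' L"
  shows "lin_ext L (lin_ext K x) = lin_ext (lin_ext L \<circ> K) x"
proof
  fix c
  define A where "A = {a. wt a \<le> wt'' c \<and> x a \<noteq> 0}"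
  define B where "B = (\<Union>a\<in>A. {b. wt' b \<le> wt'' c \<and> K a b \<noteq> 0})"
  have nonzero_in: "a \<in> A \<and> b \<in> B" if "x a \<noteq> 0" "K a b \<noteq> 0" "L b c \<noteq> 0" for a b
    using that filtered_mat_le [OF K] filtered_mat_le [OF L] unfolding A_def B_def
    by (fastforce intro: order_trans)
  have finite: "finite (B \<times> A)"
    using x filtered_mat_row [OF K] by (auto simp: A_def B_def locally_finite_def)
  have "lin_ext L (lin_ext K x) c = (\<Sum>b. \<Sum>a. x a * K a b * L b c)"
    using finite_lin_ext_support [OF x K] by (simp add: lin_ext_apply Sum_any_left_distrib)
  also have "\<dots> = (\<Sum>a. \<Sum>b. x a * K a b * L b c)"
    by (rule Sum_any.swap [OF finite]) (use nonzero_in in auto)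
  also have "\<dots> = lin_ext (lin_ext L \<circ> K) x c"
    using finite_lin_ext_support [OF filtered_mat_row [OF K] L]
    by (simp add: lin_ext_apply Sum_any_right_distrib mult.assoc)
  finally show "lin_ext L (lin_ext K x) c = lin_ext (lin_ext L \<circ> K) x c" .
qed

lemma lin_ext_agree:
  assumes "filtered_mat wt wt' K" "\<And>a. wt a \<le> wt' b \<Longrightarrow> x a = y a"
  shows "lin_ext K x b = lin_ext K y b"
proof -
  have "x a * K a b = y a * K a b" for a
    using assms filtered_mat_le [OF assms(1), of a b] by (cases "K a b = 0") auto
  then show ?thesis unfolding lin_ext_apply by (rule Sum_any.cong)
qed

lemma lin_ext_basis_vec_image:
  fixes x :: "'a \<Rightarrow> 'k::field"
  assumes "inj g"
  shows "lin_ext (\<lambda>a. basis_vec (g a)) x (g a) = x a"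
proof -
  have "basis_vec (g c) (g a) = (basis_vec c a :: 'k)" for c
    using assms by (simp add: basis_vec_def inj_eq)
  then have "lin_ext (\<lambda>a. basis_vec (g a)) x (g a) = lin_ext basis_vec x a"
    unfolding lin_ext_apply by simp
  then show ?thesis by simp
qed

lemma fin_supp_iff_locally_finite: "fin_supp x \<longleftrightarrow> locally_finite (\<lambda>_. 0) x"
  by (simp add: fin_supp_def locally_finite_def)

lemmas fin_supp_zero = locally_finite_zero [of "\<lambda>_. 0", folded fin_supp_iff_locally_finite]
  and fin_supp_basis_vec = locally_finite_basis_vec [of "\<lambda>_. 0", folded fin_supp_iff_locally_finite]
  and fin_supp_add = locally_finite_add [of "\<lambda>_. 0", folded fin_supp_iff_locally_finite]
  and fin_supp_scale = locally_finite_scale [of "\<lambda>_. 0", folded fin_supp_iff_locally_finite]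
  and fin_supp_uminus = locally_finite_uminus [of "\<lambda>_. 0", folded fin_supp_iff_locally_finite]
  and fin_supp_diff = locally_finite_diff [of "\<lambda>_. 0", folded fin_supp_iff_locally_finite]

lemma filtered_fin_supp: "(\<And>m. fin_supp (h m)) \<Longrightarrow> filtered_mat (\<lambda>_. 0) (\<lambda>_. 0) h"
  by (simp add: filtered_mat_def locally_finite_def fin_supp_def)

lemma fin_supp_lin_ext: "fin_supp x \<Longrightarrow> (\<And>a. fin_supp (K a)) \<Longrightarrow> fin_supp (lin_ext K x)"
  unfolding fin_supp_iff_locally_finite
  by (rule locally_finite_lin_ext, assumption)
    (rule filtered_fin_supp, simp add: fin_supp_iff_locally_finite)

lemma lin_ext_add_fin_supp:
  assumes "fin_supp x" "fin_supp y" "\<And>a. fin_supp (K a)"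
  shows "lin_ext K (x + y) = lin_ext K x + lin_ext K y"
  using assms(1,2) unfolding fin_supp_iff_locally_finite
  by (rule lin_ext_add) (rule filtered_fin_supp [OF assms(3)])

lemma lin_ext_diff_fin_supp:
  assumes "fin_supp x" "fin_supp y" "\<And>a. fin_supp (K a)"
  shows "lin_ext K (x - y) = lin_ext K x - lin_ext K y"
  using assms(1,2) unfolding fin_supp_iff_locally_finite
  by (rule lin_ext_diff) (rule filtered_fin_supp [OF assms(3)])

lemma homog_zero [simp]: "homog deg n 0"
  by (simp add: homog_def)

lemma homog_basis_vec [simp]: "homog deg (deg a) (basis_vec a)"
  by (simp add: homog_def basis_vec_def)

lemma homog_add: "homog deg n x \<Longrightarrow> homog deg n y \<Longrightarrow> homog deg n (x + y :: 'a \<Rightarrow> 'k::field)"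
  unfolding homog_def plus_fun_apply by (metis add_0)

lemma homog_scale: "homog deg n x \<Longrightarrow> homog deg n (c *\<^sub>f x)"
  by (simp add: homog_def)

lemma homog_uminus: "homog deg n x \<Longrightarrow> homog deg n (- x :: 'a \<Rightarrow> 'k::field)"
  by (simp add: homog_def)

lemma homog_diff: "homog deg n x \<Longrightarrow> homog deg n y \<Longrightarrow> homog deg n (x - y :: 'a \<Rightarrow> 'k::field)"
  using homog_add [of deg n x "- y"] by (simp add: homog_uminus)

lemma homog_lin_ext:
  assumes "homog deg n x" "\<And>a. homog deg' (deg a + k) (K a)"
  shows "homog deg' (n + k) (lin_ext K x)"
  using assms unfolding homog_def by (metis lin_ext_nonzeroE)

section \<open>Words and bimodule maps\<close>

lemma ksign_mult_self [simp]: "ksign a * ksign a = 1"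
  by (simp add: ksign_def)

lemma ksign_add: "ksign (a + b) = ksign a * ksign b"
  by (auto simp: ksign_def)

lemma ksign_0 [simp]: "ksign 0 = 1"
  by (simp add: ksign_def)

lemma ksign_1 [simp]: "ksign 1 = -1"
  by (simp add: ksign_def)

lemma ksign_uminus [simp]: "ksign (- a) = ksign a"
  by (simp add: ksign_def)

lemma wdeg_append [simp]: "wdeg degc (u @ v) = wdeg degc u + wdeg degc v"
  by (simp add: wdeg_def)

lemma wdeg_Nil [simp]: "wdeg degc [] = 0"
  by (simp add: wdeg_def)

lemma wdeg_Cons [simp]: "wdeg degc (c # v) = degc c + wdeg degc v"
  by (simp add: wdeg_def)

lemma tdeg_simp [simp]: "tdeg degc degm (u, m, v) = wdeg degc u + degm m + wdeg degc v"
  by (simp add: tdeg_def)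

definition tlen :: "'c list \<times> 'm \<times> 'c list \<Rightarrow> nat"
  where "tlen = (\<lambda>(u, m, v). length u + length v)"

lemma tlen_simp [simp]: "tlen (u, m, v) = length u + length v"
  by (simp add: tlen_def)

lemma adm_BM_iff_locally_finite: "adm_BM x \<longleftrightarrow> locally_finite tlen x"
proof
  assume x: "adm_BM x"
  show "locally_finite tlen x"
    unfolding locally_finite_def
  proof
    fix n
    have "{t. tlen t \<le> n \<and> x t \<noteq> 0}
        \<subseteq> (\<Union>i\<in>{..n}. \<Union>j\<in>{..n}. {(u, m, v). length u = i \<and> length v = j \<and> x (u, m, v) \<noteq> 0})"
      by auto
    then show "finite {t. tlen t \<le> n \<and> x t \<noteq> 0}"
      by (rule finite_subset) (use x in \<open>auto simp: adm_BM_def\<close>)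
  qed
next
  assume x: "locally_finite tlen x"
  show "adm_BM x"
    unfolding adm_BM_def
  proof (intro allI)
    fix i j
    have "{(u, m, v). length u = i \<and> length v = j \<and> x (u, m, v) \<noteq> 0} \<subseteq> {t. tlen t \<le> i + j \<and> x t \<noteq> 0}"
      by auto
    then show "finite {(u, m, v). length u = i \<and> length v = j \<and> x (u, m, v) \<noteq> 0}"
      by (rule finite_subset) (use x in \<open>simp add: locally_finite_def\<close>)
  qed
qed

lemmas adm_BM_add = locally_finite_add [of tlen, folded adm_BM_iff_locally_finite]
  and adm_BM_scale = locally_finite_scale [of tlen, folded adm_BM_iff_locally_finite]
  and adm_BM_uminus = locally_finite_uminus [of tlen, folded adm_BM_iff_locally_finite]
  and adm_BM_diff = locally_finite_diff [of tlen, folded adm_BM_iff_locally_finite]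
  and adm_BM_basis_vec = locally_finite_basis_vec [of tlen, folded adm_BM_iff_locally_finite]

definition wrap_index :: "'c list \<Rightarrow> 'c list \<Rightarrow> 'c list \<times> 'n \<times> 'c list \<Rightarrow> 'c list \<times> 'n \<times> 'c list"
  where "wrap_index u v = (\<lambda>(p, n, q). (u @ p, n, q @ v))"

definition wrap :: "'c list \<Rightarrow> 'c list \<Rightarrow> ('c list \<times> 'n \<times> 'c list \<Rightarrow> 'k::field)
    \<Rightarrow> 'c list \<times> 'n \<times> 'c list \<Rightarrow> 'k"
  where "wrap u v = lin_ext (\<lambda>t. basis_vec (wrap_index u v t))"

lemma wrap_index_simp [simp]: "wrap_index u v (p, n, q) = (u @ p, n, q @ v)"
  by (simp add: wrap_index_def)

lemma inj_wrap_index: "inj (wrap_index u v)"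
  by (auto simp: inj_def wrap_index_def)

lemma tlen_wrap_index [simp]: "tlen (wrap_index u v t) = length u + tlen t + length v"
  by (cases t) simp

lemma filtered_wrap: "filtered_mat tlen tlen (\<lambda>t. basis_vec (wrap_index u v t))"
  by (rule filtered_mat_basis_vec_image) simp

lemma wrap_wrap_index [simp]: "wrap u v y (wrap_index u v t) = y t"
  unfolding wrap_def by (rule lin_ext_basis_vec_image [OF inj_wrap_index])

lemma wrap_append [simp]: "wrap u v y (u @ p, n, q @ v) = y (p, n, q)"
  using wrap_wrap_index [of u v y "(p, n, q)"] by simp

lemma wrap_nonzeroE:
  assumes "wrap u v y t \<noteq> 0"
  obtains s where "t = wrap_index u v s" "y s \<noteq> 0"
  using assms unfolding wrap_def
  by (auto simp: basis_vec_def elim!: lin_ext_nonzeroE split: if_splits)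

lemma wrap_eq_zeroI: "(\<And>s. t = wrap_index u v s \<Longrightarrow> y s = 0) \<Longrightarrow> wrap u v y t = 0"
  by (metis wrap_nonzeroE)

lemma wrap_Nil [simp]: "wrap [] [] y = y"
  using wrap_append [of "[]" "[]" y] by (auto simp: fun_eq_iff)

lemma wrap_basis_vec [simp]: "wrap u v (basis_vec t) = basis_vec (wrap_index u v t)"
  by (simp add: wrap_def)

lemma wrap_scale: "wrap u v (c *\<^sub>f y) = c *\<^sub>f wrap u v y"
  by (simp add: wrap_def lin_ext_scale)

lemma wrap_add:
  assumes "adm_BM x" "adm_BM y"
  shows "wrap u v (x + y) = wrap u v x + wrap u v y"
  using assms unfolding wrap_def adm_BM_iff_locally_finite
  by (rule lin_ext_add) (rule filtered_wrap)

lemma wrap_wrap: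
  assumes "adm_BM y"
  shows "wrap u v (wrap u' v' y) = wrap (u @ u') (v' @ v) y"
proof -
  have "wrap u v (wrap u' v' y)
      = lin_ext (wrap u v \<circ> (\<lambda>t. basis_vec (wrap_index u' v' t))) y"
    using assms unfolding wrap_def adm_BM_iff_locally_finite
    by (rule lin_ext_comp) (rule filtered_wrap)+
  also have "wrap u v \<circ> (\<lambda>t. basis_vec (wrap_index u' v' t))
      = (\<lambda>t. basis_vec (wrap_index (u @ u') (v' @ v) t))"
    by (auto simp: fun_eq_iff)
  finally show ?thesis by (simp add: wrap_def)
qed

definition bimod_mat :: "('c \<Rightarrow> int) \<Rightarrow> int \<Rightarrow> ('m \<Rightarrow> 'c list \<times> 'n \<times> 'c list \<Rightarrow> 'k::field)
    \<Rightarrow> 'c list \<times> 'm \<times> 'c list \<Rightarrow> 'c list \<times> 'n \<times> 'c list \<Rightarrow> 'k"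
  where "bimod_mat degc e \<phi> = (\<lambda>(u, m, v). ksign (e * wdeg degc u) *\<^sub>f wrap u v (\<phi> m))"

abbreviation "bimod_ext degc e \<phi> \<equiv> lin_ext (bimod_mat degc e \<phi>)"

lemma bimod_mat_simp: "bimod_mat degc e \<phi> (u, m, v) = ksign (e * wdeg degc u) *\<^sub>f wrap u v (\<phi> m)"
  by (simp add: bimod_mat_def)

lemma bimod_mat_generator [simp]: "bimod_mat degc e \<phi> ([], m, []) = \<phi> m"
  by (simp add: bimod_mat_simp)

lemma filtered_bimod_mat:
  fixes \<phi> :: "'m \<Rightarrow> 'c list \<times> 'n \<times> 'c list \<Rightarrow> 'k::field"
  assumes "\<And>m. adm_BM (\<phi> m)"
  shows "filtered_mat tlen tlen (bimod_mat degc e \<phi>)"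
  unfolding filtered_mat_def
proof (intro conjI allI impI)
  fix t :: "'c list \<times> 'm \<times> 'c list"
  obtain u m v where t: "t = (u, m, v)" by (cases t)
  show "locally_finite tlen (bimod_mat degc e \<phi> t)"
    using assms [of m] unfolding t bimod_mat_simp wrap_def adm_BM_iff_locally_finite
    by (intro locally_finite_scale) (rule locally_finite_lin_ext [OF _ filtered_wrap])
  fix s assume "bimod_mat degc e \<phi> t s \<noteq> 0"
  then have "wrap u v (\<phi> m) s \<noteq> 0" by (simp add: t bimod_mat_simp)
  then show "tlen t \<le> tlen s" by (rule wrap_nonzeroE) (simp add: t)
qed

lemma adm_BM_bimod_ext: "adm_BM x \<Longrightarrow> (\<And>m. adm_BM (\<phi> m)) \<Longrightarrow> adm_BM (bimod_ext degc e \<phi> x)"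
  unfolding adm_BM_iff_locally_finite
  by (rule locally_finite_lin_ext, assumption)
    (rule filtered_bimod_mat, simp add: adm_BM_iff_locally_finite)

lemma homog_bimod_ext:
  fixes \<phi> :: "'m \<Rightarrow> 'c list \<times> 'n \<times> 'c list \<Rightarrow> 'k::field"
  assumes "homog (tdeg degc degm) k x" "\<And>m. homog (tdeg degc degn) (degm m + e) (\<phi> m)"
  shows "homog (tdeg degc degn) (k + e) (bimod_ext degc e' \<phi> x)"
proof (rule homog_lin_ext [OF assms(1)])
  fix t :: "'c list \<times> 'm \<times> 'c list"
  obtain u m v where t: "t = (u, m, v)" by (cases t)
  have "homog (tdeg degc degn) (degm m + e + (wdeg degc u + wdeg degc v)) (wrap u v (\<phi> m))"
    unfolding wrap_def
  proof (rule homog_lin_ext [OF assms(2)])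
    fix s :: "'c list \<times> 'n \<times> 'c list"
    have "tdeg degc degn (wrap_index u v s) = tdeg degc degn s + (wdeg degc u + wdeg degc v)"
      by (cases s) simp
    then show "homog (tdeg degc degn) (tdeg degc degn s + (wdeg degc u + wdeg degc v))
        (basis_vec (wrap_index u v s))"
      using homog_basis_vec by metis
  qed
  then show "homog (tdeg degc degn) (tdeg degc degm t + e) (bimod_mat degc e' \<phi> t)"
    unfolding t bimod_mat_simp by (intro homog_scale) (simp add: algebra_simps)
qed

lemma bimod_ext_wrap:
  assumes "adm_BM y" "\<And>m. adm_BM (\<psi> m)"
  shows "bimod_ext degc e \<psi> (wrap u v y)
      = ksign (e * wdeg degc u) *\<^sub>f wrap u v (bimod_ext degc e \<psi> y)"
proof -
  have y: "locally_finite tlen y" using assms(1) by (simp add: adm_BM_iff_locally_finite)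
  have \<psi>: "filtered_mat tlen tlen (bimod_mat degc e \<psi>)"
    by (rule filtered_bimod_mat) (rule assms(2))
  have rows: "bimod_ext degc e \<psi> \<circ> (\<lambda>t. basis_vec (wrap_index u v t))
      = (\<lambda>t. ksign (e * wdeg degc u) *\<^sub>f (wrap u v \<circ> bimod_mat degc e \<psi>) t)"
  proof
    fix t show "(bimod_ext degc e \<psi> \<circ> (\<lambda>t. basis_vec (wrap_index u v t))) t
        = ksign (e * wdeg degc u) *\<^sub>f (wrap u v \<circ> bimod_mat degc e \<psi>) t"
      by (cases t) (simp add: bimod_mat_simp wrap_scale wrap_wrap assms(2) ksign_add distrib_left
          fun_eq_iff)
  qed
  have "bimod_ext degc e \<psi> (wrap u v y)
      = lin_ext (bimod_ext degc e \<psi> \<circ> (\<lambda>t. basis_vec (wrap_index u v t))) y"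
    unfolding wrap_def by (rule lin_ext_comp [OF y filtered_wrap \<psi>])
  also have "\<dots> = ksign (e * wdeg degc u) *\<^sub>f lin_ext (wrap u v \<circ> bimod_mat degc e \<psi>) y"
    unfolding rows lin_ext_scale_mat ..
  also have "lin_ext (wrap u v \<circ> bimod_mat degc e \<psi>) y = wrap u v (bimod_ext degc e \<psi> y)"
    unfolding wrap_def by (rule lin_ext_comp [OF y \<psi> filtered_wrap, symmetric])
  finally show ?thesis .
qed

lemma bimod_mat_comp:
  assumes "\<And>m. adm_BM (\<phi> m)" "\<And>n. adm_BM (\<psi> n)"
  shows "bimod_ext degc e' \<psi> \<circ> bimod_mat degc e \<phi> = bimod_mat degc (e + e') (bimod_ext degc e' \<psi> \<circ> \<phi>)"
  by (auto simp: fun_eq_iff bimod_mat_simp lin_ext_scale bimod_ext_wrap assms ksign_add distrib_right)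

lemma bimod_ext_comp:
  assumes "adm_BM x" "\<And>m. adm_BM (\<phi> m)" "\<And>n. adm_BM (\<psi> n)"
  shows "bimod_ext degc e' \<psi> (bimod_ext degc e \<phi> x)
      = bimod_ext degc (e + e') (bimod_ext degc e' \<psi> \<circ> \<phi>) x"
  unfolding bimod_mat_comp [OF assms(2,3), symmetric]
  by (rule lin_ext_comp) (use assms in
      \<open>auto simp: adm_BM_iff_locally_finite intro: filtered_bimod_mat\<close>)

lemma bimod_ext_add_gens:
  fixes \<phi> \<psi> :: "'m \<Rightarrow> 'c list \<times> 'n \<times> 'c list \<Rightarrow> 'k::field"
  assumes "adm_BM x" "\<And>m. adm_BM (\<phi> m)" "\<And>m. adm_BM (\<psi> m)"
  shows "bimod_ext degc e (\<phi> + \<psi>) x = bimod_ext degc e \<phi> x + bimod_ext degc e \<psi> x"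
proof -
  have "bimod_mat degc e (\<phi> + \<psi>) = bimod_mat degc e \<phi> + bimod_mat degc e \<psi>"
    using assms(2,3) by (auto simp: fun_eq_iff bimod_mat_simp wrap_add distrib_left)
  moreover have "lin_ext (bimod_mat degc e \<phi> + bimod_mat degc e \<psi>) x
      = bimod_ext degc e \<phi> x + bimod_ext degc e \<psi> x"
    using assms(1) unfolding adm_BM_iff_locally_finite
    by (rule lin_ext_add_mat) (rule filtered_bimod_mat, rule assms)+
  ultimately show ?thesis by (simp only:)
qed

lemma bimod_mat_basis_vec: "bimod_mat degc 0 (\<lambda>m. basis_vec ([], m, [])) = basis_vec"
  by (auto simp: fun_eq_iff bimod_mat_simp)

section \<open>The structure maps as matrices\<close>

lemma sum_slice_eq_Sum_any:
  fixes x :: "'a \<Rightarrow> 'k::field"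
  assumes inj: "inj e" and fin: "finite {j. x (e j) \<noteq> 0}"
    and \<kappa>: "\<And>a. \<kappa> a = (\<Sum>j | basis_vec a (e j) \<noteq> (0 :: 'k). basis_vec a (e j) * k j)"
  shows "(\<Sum>j | x (e j) \<noteq> 0. x (e j) * k j) = (\<Sum>a. x a * \<kappa> a)"
    and "finite {a. x a * \<kappa> a \<noteq> 0}"
proof -
  have "{j'. basis_vec (e j) (e j') \<noteq> (0 :: 'k)} = {j}" for j
    using inj by (auto simp: basis_vec_def inj_eq)
  then have \<kappa>_slice: "\<kappa> (e j) = k j" for j
    by (simp add: \<kappa> basis_vec_def)
  have \<kappa>_outside: "a \<in> range e" if "\<kappa> a \<noteq> 0" for a
  proof (rule ccontr)
    assume "a \<notin> range e"
    then have "\<kappa> a = 0" by (auto simp: \<kappa> basis_vec_def intro!: sum.neutral)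
    with that show False ..
  qed
  have "(\<Sum>a. x a * \<kappa> a) = (\<Sum>j. x (e j) * k j)"
    by (subst Sum_any_reindex_inj [OF inj]) (auto simp: \<kappa>_slice \<kappa>_outside)
  also have "\<dots> = (\<Sum>j | x (e j) \<noteq> 0. x (e j) * k j)"
    by (rule Sum_any.expand_superset [OF fin]) auto
  finally show "(\<Sum>j | x (e j) \<noteq> 0. x (e j) * k j) = (\<Sum>a. x a * \<kappa> a)" ..
  have "{a. x a * \<kappa> a \<noteq> 0} \<subseteq> e ` {j. x (e j) \<noteq> 0}"
    using \<kappa>_outside by auto
  then show "finite {a. x a * \<kappa> a \<noteq> 0}"
    using fin by (rule finite_subset [OF _ finite_imageI])
qed

lemma Sum_any_sum:
  assumes "finite I" "\<And>i. i \<in> I \<Longrightarrow> finite {a. g i a \<noteq> 0}"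
  shows "(\<Sum>a. \<Sum>i\<in>I. g i a) = (\<Sum>i\<in>I. \<Sum>a. g i a)"
proof -
  let ?A = "\<Union>i\<in>I. {a. g i a \<noteq> 0}"
  have A: "finite ?A" using assms by blast
  have "{a. (\<Sum>i\<in>I. g i a) \<noteq> 0} \<subseteq> ?A"
    by (auto elim: sum.not_neutral_contains_not_neutral)
  then have "(\<Sum>a. \<Sum>i\<in>I. g i a) = (\<Sum>a\<in>?A. \<Sum>i\<in>I. g i a)"
    by (rule Sum_any.expand_superset [OF A])
  also have "\<dots> = (\<Sum>i\<in>I. \<Sum>a\<in>?A. g i a)"
    by (rule sum.swap)
  also have "\<dots> = (\<Sum>i\<in>I. \<Sum>a. g i a)"
    by (intro sum.cong refl Sum_any.expand_superset [OF A, symmetric]) auto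
  finally show ?thesis .
qed

lemma sum_slices_eq_lin_ext:
  fixes x :: "'a \<Rightarrow> 'k::field"
  assumes x: "locally_finite wt x" and I: "finite I"
    and inj: "\<And>i. inj (e i)" and wt: "\<And>i j. i \<in> I \<Longrightarrow> wt (e i j) \<le> n"
    and K: "\<And>a. K a b = (\<Sum>i\<in>I. \<Sum>j | basis_vec a (e i j) \<noteq> (0 :: 'k). basis_vec a (e i j) * k i j)"
  shows "(\<Sum>i\<in>I. \<Sum>j | x (e i j) \<noteq> 0. x (e i j) * k i j) = lin_ext K x b"
proof -
  define \<kappa> where "\<kappa> i a = (\<Sum>j | basis_vec a (e i j) \<noteq> (0 :: 'k). basis_vec a (e i j) * k i j)" for i a
  have "finite {j. x (e i j) \<noteq> 0}" if "i \<in> I" for i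
    using locally_finite_slice [OF x inj, of i "\<lambda>_. 0" n] wt [OF that]
    by (simp add: locally_finite_def)
  note slice = sum_slice_eq_Sum_any [OF inj this, of _ "\<kappa> _", OF _ \<kappa>_def]
  have "lin_ext K x b = (\<Sum>a. \<Sum>i\<in>I. x a * \<kappa> i a)"
    by (simp only: lin_ext_apply K sum_distrib_left \<kappa>_def)
  also have "\<dots> = (\<Sum>i\<in>I. \<Sum>a. x a * \<kappa> i a)"
    by (rule Sum_any_sum [OF I slice(2)])
  also have "\<dots> = (\<Sum>i\<in>I. \<Sum>j | x (e i j) \<noteq> 0. x (e i j) * k i j)"
    by (intro sum.cong refl) (simp add: slice(1))
  finally show ?thesis ..
qed

lemma finite_splits [simp]: "finite {(u, p). u @ p = w}"
proof -
  have "(u, p) \<in> (\<lambda>i. (take i w, drop i w)) ` {..length w}" if "u @ p = w" for u p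
    using that by (intro image_eqI [of _ _ "length u"]) auto
  then have "{(u, p). u @ p = w} \<subseteq> (\<lambda>i. (take i w, drop i w)) ` {..length w}"
    by auto
  then show ?thesis by (rule finite_subset) simp
qed

lemma finite_splits3 [simp]: "finite {(u, v, z). u @ v @ z = w}"
proof -
  have "{(u, v, z). u @ v @ z = w}
      \<subseteq> (\<Union>(u, p)\<in>{(u, p). u @ p = w}. (\<lambda>(v, z). (u, v, z)) ` {(v, z). v @ z = p})"
    by auto
  then show ?thesis by (rule finite_subset) auto
qed

lemma bimod_mat_eq_sum:
  fixes \<phi> :: "'m \<Rightarrow> 'c list \<times> 'n \<times> 'c list \<Rightarrow> 'k::field"
  shows "bimod_mat degc e \<phi> t (u', n, v')
    = (\<Sum>((u, p), (q, z))\<in>{(u, p). u @ p = u'} \<times> {(q, z). q @ z = v'}.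
        \<Sum>m | basis_vec t (u, m, z) \<noteq> (0 :: 'k).
          basis_vec t (u, m, z) * (ksign (e * wdeg degc u) * \<phi> m (p, n, q)))"
    (is "_ = (\<Sum>((u, p), (q, z))\<in>?I. ?row u p q z)")
proof -
  obtain u m v where t: "t = (u, m, v)" by (cases t)
  have row: "?row u' p q z
      = (if u' = u \<and> z = v then ksign (e * wdeg degc u) * \<phi> m (p, n, q) else 0)" for u' p q z
    by (auto simp: t basis_vec_def)
  show ?thesis
  proof (cases "\<exists>p q. u' = u @ p \<and> v' = q @ v")
    case True
    then obtain p q where split: "u' = u @ p" "v' = q @ v" by blast
    have "(\<Sum>((u, p), (q, z))\<in>?I. ?row u p q z) = (\<Sum>((u, p), (q, z))\<in>{((u, p), (q, v))}. ?row u p q z)"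
      by (rule sum.mono_neutral_right) (auto simp: row split split: if_splits)
    then show ?thesis
      by (simp add: row) (simp add: t split bimod_mat_simp)
  next
    case False
    have "wrap u v (\<phi> m) (u', n, v') = 0"
      by (rule wrap_eq_zeroI) (use False in \<open>auto simp: wrap_index_def split: prod.splits\<close>)
    moreover have "(\<Sum>((u, p), (q, z))\<in>?I. ?row u p q z) = 0"
      using False by (intro sum.neutral) (auto simp: row)
    ultimately show ?thesis by (simp add: t bimod_mat_simp)
  qed
qed

lemma bimod_ext_apply:
  fixes \<phi> :: "'m \<Rightarrow> 'c list \<times> 'n \<times> 'c list \<Rightarrow> 'k::field"
  assumes x: "adm_BM x"
  shows "bimod_ext degc e \<phi> x (u', n, v')
    = (\<Sum>(u, p)\<in>{(u, p). u @ p = u'}. \<Sum>(q, z)\<in>{(q, z). q @ z = v'}.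
        \<Sum>m | x (u, m, z) \<noteq> 0. ksign (e * wdeg degc u) * x (u, m, z) * \<phi> m (p, n, q))"
proof -
  let ?I = "{(u, p). u @ p = u'} \<times> {(q, z). q @ z = v'}"
  define slot where "slot i m = (fst (fst i), m, snd (snd i))"
    for i :: "('c list \<times> 'c list) \<times> 'c list \<times> 'c list" and m :: 'm
  define k where "k = (\<lambda>((u, p), (q, z :: 'c list)) m. ksign (e * wdeg degc u) * \<phi> m (p, n, q))"
  have "inj (slot i)" for i
    by (simp add: slot_def inj_def)
  moreover have "tlen (slot i m) \<le> length u' + length v'" if "i \<in> ?I" for i m
    using that by (auto simp: slot_def)
  ultimately have "(\<Sum>i\<in>?I. \<Sum>m | x (slot i m) \<noteq> 0. x (slot i m) * k i m)
      = bimod_ext degc e \<phi> x (u', n, v')"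
    by (intro sum_slices_eq_lin_ext [OF x [unfolded adm_BM_iff_locally_finite]])
      (simp_all add: bimod_mat_eq_sum slot_def k_def inj_def case_prod_beta)
  then show ?thesis
    by (simp add: sum.cartesian_product slot_def k_def case_prod_beta mult_ac)
qed

lemma Fext_eq_bimod_ext: "adm_BM x \<Longrightarrow> Fext f x = bimod_ext degc 0 f x"
  by (auto simp: fun_eq_iff Fext_def bimod_ext_apply)

definition kron :: "('a \<Rightarrow> 'b \<Rightarrow> 'k::field) \<Rightarrow> ('c \<Rightarrow> 'd \<Rightarrow> 'k) \<Rightarrow> 'a \<times> 'c \<Rightarrow> 'b \<times> 'd \<Rightarrow> 'k" (infixr "\<otimes>" 70)
  where "A \<otimes> B = (\<lambda>(a, c) (b, d). A a b * B c d)"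

lemma kron_simp [simp]: "(A \<otimes> B) (a, c) (b, d) = A a b * B c d"
  by (simp add: kron_def)

definition prod_wt :: "('a \<Rightarrow> nat) \<Rightarrow> ('b \<Rightarrow> nat) \<Rightarrow> 'a \<times> 'b \<Rightarrow> nat"
  where "prod_wt wt wt' = (\<lambda>(a, b). wt a + wt' b)"

lemma tlen_eq_prod_wt: "tlen = prod_wt length (prod_wt (\<lambda>_. 0) length)"
  by (auto simp: fun_eq_iff prod_wt_def)

lemma filtered_kron:
  fixes A :: "'a \<Rightarrow> 'b \<Rightarrow> 'k::field" and B :: "'c \<Rightarrow> 'd \<Rightarrow> 'k"
  assumes A: "filtered_mat wa wb A" and B: "filtered_mat wc wd B"
  shows "filtered_mat (prod_wt wa wc) (prod_wt wb wd) (A \<otimes> B)"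
  unfolding filtered_mat_def
proof (intro conjI allI impI)
  fix s :: "'a \<times> 'c"
  obtain a c where s: "s = (a, c)" by (cases s)
  show "locally_finite (prod_wt wb wd) ((A \<otimes> B) s)"
    unfolding locally_finite_def
  proof
    fix n
    have "{t. prod_wt wb wd t \<le> n \<and> (A \<otimes> B) s t \<noteq> 0}
        \<subseteq> {b. wb b \<le> n \<and> A a b \<noteq> 0} \<times> {d. wd d \<le> n \<and> B c d \<noteq> 0}"
      by (auto simp: s prod_wt_def)
    moreover have "finite ({b. wb b \<le> n \<and> A a b \<noteq> 0} \<times> {d. wd d \<le> n \<and> B c d \<noteq> 0})"
      using filtered_mat_row [OF A] filtered_mat_row [OF B] by (simp add: locally_finite_def)
    ultimately show "finite {t. prod_wt wb wd t \<le> n \<and> (A \<otimes> B) s t \<noteq> 0}"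
      by (rule finite_subset)
  qed
  fix t
  show "prod_wt wa wc s \<le> prod_wt wb wd t" if "(A \<otimes> B) s t \<noteq> 0"
    using that filtered_mat_le [OF A] filtered_mat_le [OF B]
    by (cases t) (auto simp: s prod_wt_def intro: add_mono)
qed

lemma kron_comp:
  assumes A: "filtered_mat wa wa' A" "filtered_mat wa' wa'' A'"
    and B: "filtered_mat wb wb' B" "filtered_mat wb' wb'' B'"
  shows "lin_ext (A' \<otimes> B') \<circ> (A \<otimes> B) = (lin_ext A' \<circ> A) \<otimes> (lin_ext B' \<circ> B)"
proof (rule ext, rule ext, clarify)
  fix a b a'' b''
  note finA = finite_lin_ext_support [OF filtered_mat_row [OF A(1)] A(2), of a a'']
  note finB = finite_lin_ext_support [OF filtered_mat_row [OF B(1)] B(2), of b b'']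
  let ?S = "{a'. A a a' \<noteq> 0 \<and> A' a' a'' \<noteq> 0} \<times> {b'. B b b' \<noteq> 0 \<and> B' b' b'' \<noteq> 0}"
  have "(lin_ext (A' \<otimes> B') \<circ> (A \<otimes> B)) (a, b) (a'', b'')
      = (\<Sum>(a', b'). A a a' * A' a' a'' * (B b b' * B' b' b''))"
    by (simp add: lin_ext_apply case_prod_beta kron_def mult_ac)
  also have "\<dots> = (\<Sum>a'. \<Sum>b'. A a a' * A' a' a'' * (B b b' * B' b' b''))"
    by (rule Sum_any.cartesian_product [symmetric, of ?S]) (use finA finB in auto)
  also have "\<dots> = (\<Sum>a'. A a a' * A' a' a'') * (\<Sum>b'. B b b' * B' b' b'')"
    by (subst Sum_any_left_distrib) (use finA finB in \<open>simp_all add: Sum_any_right_distrib\<close>)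
  finally show "(lin_ext (A' \<otimes> B') \<circ> (A \<otimes> B)) (a, b) (a'', b'')
      = ((lin_ext A' \<circ> A) \<otimes> (lin_ext B' \<circ> B)) (a, b) (a'', b'')"
    by (simp add: lin_ext_apply)
qed

lemma kron_basis_vec [simp]: "basis_vec \<otimes> basis_vec = basis_vec"
  by (auto simp: fun_eq_iff basis_vec_def)

lemma kron_scale_left: "(\<lambda>a. c *\<^sub>f A a) \<otimes> B = (\<lambda>t. c *\<^sub>f (A \<otimes> B) t)"
  by (auto simp: fun_eq_iff)

lemma kron_scale_right: "A \<otimes> (\<lambda>b. c *\<^sub>f B b) = (\<lambda>t. c *\<^sub>f (A \<otimes> B) t)"
  by (auto simp: fun_eq_iff)

definition sign_mat :: "('a \<Rightarrow> int) \<Rightarrow> 'a \<Rightarrow> 'a \<Rightarrow> 'k::field"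
  where "sign_mat deg a = ksign (deg a) *\<^sub>f basis_vec a"

lemma filtered_sign_mat: "filtered_mat wt wt (sign_mat deg)"
  by (simp add: filtered_mat_def sign_mat_def locally_finite_scale) (simp add: basis_vec_def)

lemma lin_ext_sign_mat: "lin_ext (sign_mat deg) y b = ksign (deg b) * y b"
proof -
  have "y a * sign_mat deg a b = (if a = b then ksign (deg a) * y a else 0)" for a
    by (simp add: sign_mat_def basis_vec_def)
  then show ?thesis unfolding lin_ext_apply by simp
qed

lemma sign_mat_comp: "lin_ext (sign_mat deg') \<circ> sign_mat deg = sign_mat (\<lambda>a. deg a + deg' a)"
  by (auto simp: fun_eq_iff lin_ext_sign_mat sign_mat_def basis_vec_def ksign_add)

lemma sign_mat_commute:
  assumes "\<And>a b. K a b \<noteq> 0 \<Longrightarrow> ksign (deg' b) = c * ksign (deg a)"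
  shows "lin_ext (sign_mat deg') \<circ> K = (\<lambda>a. c *\<^sub>f (lin_ext K \<circ> sign_mat deg) a)"
proof (rule ext, rule ext)
  fix a b
  have "ksign (deg' b) * K a b = c * (ksign (deg a) * K a b)"
    using assms by (cases "K a b = 0") auto
  then show "(lin_ext (sign_mat deg') \<circ> K) a b = (c *\<^sub>f (lin_ext K \<circ> sign_mat deg) a) b"
    by (simp add: lin_ext_sign_mat) (simp add: sign_mat_def lin_ext_scale)
qed

definition diag_gen :: "('m \<Rightarrow> 'n \<Rightarrow> 'k::field) \<Rightarrow> 'm \<Rightarrow> 'c list \<times> 'n \<times> 'c list \<Rightarrow> 'k"
  where "diag_gen h m = (basis_vec \<otimes> h \<otimes> basis_vec) ([], m, [])"

lemma diag_gen_apply: "diag_gen h m (p, n, q) = (if p = [] \<and> q = [] then h m n else 0)"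
  by (simp add: diag_gen_def basis_vec_def)

lemma adm_BM_diag_gen:
  assumes "fin_supp (h m)" shows "adm_BM (diag_gen h m)"
proof -
  have "{t. diag_gen h m t \<noteq> 0} \<subseteq> (\<lambda>n. ([], n, [])) ` {n. h m n \<noteq> 0}"
    by (auto simp: diag_gen_apply split: if_splits)
  then have "finite {t. diag_gen h m t \<noteq> 0}"
    by (rule finite_subset) (use assms in \<open>simp add: fin_supp_def\<close>)
  then show ?thesis
    by (auto simp: adm_BM_iff_locally_finite locally_finite_def)
qed

lemma homog_diag_gen: "homog degn k (h m) \<Longrightarrow> homog (tdeg degc degn) k (diag_gen h m)"
  by (auto simp: homog_def diag_gen_apply split: if_splits)

lemma bimod_mat_diag_gen:
  fixes degc :: "'c \<Rightarrow> int" and h :: "'m \<Rightarrow> 'n \<Rightarrow> 'k::field"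
  shows "bimod_mat degc e (diag_gen h) = sign_mat (\<lambda>u. e * wdeg degc u) \<otimes> h \<otimes> basis_vec"
proof (rule ext, rule ext, clarify)
  fix u v u' v' :: "'c list" and m :: 'm and n :: 'n
  have "wrap u v (diag_gen h m) (u', n, v') = (basis_vec \<otimes> h \<otimes> basis_vec) (u, m, v) (u', n, v')"
  proof (cases "u' = u \<and> v' = v")
    case True
    then show ?thesis
      using wrap_append [of u v "diag_gen h m" "[]" n "[]"]
      by (simp add: diag_gen_apply basis_vec_def)
  next
    case False
    have "wrap u v (diag_gen h m) (u', n, v') = 0"
      by (rule wrap_eq_zeroI)
        (use False in \<open>auto simp: wrap_index_def diag_gen_apply split: prod.splits\<close>)
    with False show ?thesis by (auto simp: basis_vec_def)
  qed
  then show "bimod_mat degc e (diag_gen h) (u, m, v) (u', n, v')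
      = (sign_mat (\<lambda>u. e * wdeg degc u) \<otimes> h \<otimes> basis_vec) (u, m, v) (u', n, v')"
    by (simp add: bimod_mat_simp sign_mat_def)
qed

definition word_diff :: "('c \<Rightarrow> int) \<Rightarrow> ('c \<Rightarrow> 'c list \<Rightarrow> 'k::field) \<Rightarrow> 'c list \<Rightarrow> 'c list \<Rightarrow> 'k"
  where "word_diff degc d w = Dext degc d (basis_vec w)"

lemma word_diff_nonzeroE:
  fixes d :: "'c \<Rightarrow> 'c list \<Rightarrow> 'k::field"
  assumes "word_diff degc d w w' \<noteq> 0"
  obtains u c v z where "w = u @ [c] @ z" "w' = u @ v @ z" "d c v \<noteq> 0"
proof -
  obtain i where i: "i \<in> {(u, v, z). u @ v @ z = w'}"
    and nz: "(case i of (u, v, z) \<Rightarrow> \<Sum>c | basis_vec w (u @ [c] @ z) \<noteq> (0 :: 'k).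
      ksign (wdeg degc u) * basis_vec w (u @ [c] @ z) * d c v) \<noteq> 0"
    using assms unfolding word_diff_def Dext_def by (rule sum.not_neutral_contains_not_neutral)
  obtain u v z where uvz: "i = (u, v, z)" by (cases i)
  obtain c where "ksign (wdeg degc u) * basis_vec w (u @ [c] @ z) * d c v \<noteq> 0"
    using nz unfolding uvz prod.case by (rule sum.not_neutral_contains_not_neutral)
  then show thesis
    using i by (intro that [of u c z v]) (auto simp: uvz basis_vec_def split: if_splits)
qed

abbreviation left_diff :: "('c \<Rightarrow> int) \<Rightarrow> ('c \<Rightarrow> 'c list \<Rightarrow> 'k::field)
    \<Rightarrow> 'c list \<times> 'm \<times> 'c list \<Rightarrow> 'c list \<times> 'm \<times> 'c list \<Rightarrow> 'k"
  where "left_diff degc d \<equiv> word_diff degc d \<otimes> basis_vec"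

abbreviation right_diff :: "('c \<Rightarrow> int) \<Rightarrow> ('m \<Rightarrow> int) \<Rightarrow> ('c \<Rightarrow> 'c list \<Rightarrow> 'k::field)
    \<Rightarrow> 'c list \<times> 'm \<times> 'c list \<Rightarrow> 'c list \<times> 'm \<times> 'c list \<Rightarrow> 'k"
  where "right_diff degc degm d \<equiv> sign_mat (wdeg degc) \<otimes> sign_mat degm \<otimes> word_diff degc d"

definition deriv_mat :: "('c \<Rightarrow> int) \<Rightarrow> ('m \<Rightarrow> int) \<Rightarrow> ('c \<Rightarrow> 'c list \<Rightarrow> 'k::field)
    \<Rightarrow> ('m \<Rightarrow> 'c list \<times> 'm \<times> 'c list \<Rightarrow> 'k) \<Rightarrow> 'c list \<times> 'm \<times> 'c list \<Rightarrow> 'c list \<times> 'm \<times> 'c list \<Rightarrow> 'k"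
  where "deriv_mat degc degm d dM = left_diff degc d + bimod_mat degc 1 dM + right_diff degc degm d"

lemma Dext_eq_lin_ext:
  fixes x :: "'c list \<Rightarrow> 'k::field"
  assumes "locally_finite length x"
  shows "Dext degc d x = lin_ext (word_diff degc d) x"
proof
  fix w' :: "'c list"
  define slot where "slot = (\<lambda>(u, v :: 'c list, z) c. u @ [c :: 'c] @ z)"
  define k where "k = (\<lambda>(u, v, z :: 'c list) c. ksign (wdeg degc u) * d c v)"
  let ?I = "{(u, v, z). u @ v @ z = w'}"
  have Dext: "Dext degc d y w' = (\<Sum>i\<in>?I. \<Sum>c | y (slot i c) \<noteq> 0. y (slot i c) * k i c)" for y
    by (simp add: Dext_def slot_def k_def case_prod_beta mult_ac)
  have "inj (slot i)" for i
    by (simp add: slot_def case_prod_beta inj_def)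
  moreover have "length (slot i c) \<le> Suc (length w')" if "i \<in> ?I" for i c
    using that by (auto simp: slot_def)
  ultimately show "Dext degc d x w' = lin_ext (word_diff degc d) x w'"
    unfolding Dext
    by (intro sum_slices_eq_lin_ext [OF assms]) (simp_all add: word_diff_def Dext)
qed

lemma lin_ext_kron_basis_vec: "lin_ext (A \<otimes> basis_vec) x (b, c) = lin_ext A (\<lambda>a. x (a, c)) b"
  unfolding lin_ext_apply
  by (subst Sum_any_reindex_inj [of "\<lambda>a. (a, c)"])
    (auto simp: inj_def basis_vec_def split: if_splits)

lemma lin_ext_kron_sign_mat:
  "lin_ext (sign_mat deg \<otimes> sign_mat deg' \<otimes> A) x (u, m, v)
    = ksign (deg u + deg' m) * lin_ext A (\<lambda>w. x (u, m, w)) v"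
proof -
  have "lin_ext (sign_mat deg \<otimes> sign_mat deg' \<otimes> A) x (u, m, v)
      = (\<Sum>w. x (u, m, w) * (sign_mat deg u u * (sign_mat deg' m m * A w v)))"
    unfolding lin_ext_apply
    by (subst Sum_any_reindex_inj [of "\<lambda>w. (u, m, w)"])
      (auto simp: inj_def sign_mat_def basis_vec_def split: if_splits)
  also have "\<dots> = lin_ext A (ksign (deg u + deg' m) *\<^sub>f (\<lambda>w. x (u, m, w))) v"
    by (simp add: lin_ext_apply sign_mat_def basis_vec_def ksign_add mult_ac)
  finally show ?thesis by (simp add: lin_ext_scale)
qed

lemma DMext_eq_sum_parts:
  "DMext degc degm d dM x (u, m, v)
    = Dext degc d (\<lambda>w. x (w, m, v)) u
    + (\<Sum>(u', p)\<in>{(u', p). u' @ p = u}. \<Sum>(q, z)\<in>{(q, z). q @ z = v}.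
        \<Sum>m' | x (u', m', z) \<noteq> 0. ksign (wdeg degc u') * x (u', m', z) * dM m' (p, m, q))
    + ksign (wdeg degc u + degm m) * Dext degc d (\<lambda>w. x (u, m, w)) v"
  by (simp add: DMext_def Dext_def ksign_add sum_distrib_left mult_ac case_prod_beta)

locale uncurved_generators =
  fixes degc :: "'c \<Rightarrow> int" and d :: "'c \<Rightarrow> 'c list \<Rightarrow> 'k::field"
  assumes d_adm: "adm_B (d c)" and d_homog: "homog (wdeg degc) (degc c + 1) (d c)"
    and d_Nil: "d c [] = 0"
begin

lemma filtered_word_diff: "filtered_mat length length (word_diff degc d)"
  unfolding filtered_mat_def
proof (intro conjI allI impI)
  fix w
  show "locally_finite length (word_diff degc d w)"
    unfolding locally_finite_def
  proof
    fix n
    let ?subst = "\<lambda>i v. take i w @ v @ drop (Suc i) w"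
    let ?A = "\<Union>i<length w. ?subst i ` (\<Union>k\<le>n. {v. length v = k \<and> d (w ! i) v \<noteq> 0})"
    have "finite ?A" using d_adm by (auto simp: adm_B_def)
    moreover have "w' \<in> ?A" if w': "length w' \<le> n" "word_diff degc d w w' \<noteq> 0" for w'
    proof -
      obtain u c v z where split: "w = u @ [c] @ z" "w' = u @ v @ z" "d c v \<noteq> 0"
        using w'(2) by (rule word_diff_nonzeroE)
      then have "w' = ?subst (length u) v" "w ! length u = c" "length u < length w" "length v \<le> n"
        using w'(1) by auto
      then show ?thesis using split(3) by blast
    qed
    ultimately show "finite {w'. length w' \<le> n \<and> word_diff degc d w w' \<noteq> 0}"
      by (metis (mono_tags, lifting) mem_Collect_eq rev_finite_subset subsetI)
  qed
  fix w' assume "word_diff degc d w w' \<noteq> 0"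
  then obtain u c v z where "w = u @ [c] @ z" "w' = u @ v @ z" "d c v \<noteq> 0"
    by (rule word_diff_nonzeroE)
  moreover from this have "v \<noteq> []" using d_Nil by metis
  ultimately show "length w \<le> length w'" by (cases v) auto
qed

lemma homog_word_diff: "homog (wdeg degc) (wdeg degc w + 1) (word_diff degc d w)"
  unfolding homog_def
proof (intro allI impI)
  fix w' assume "word_diff degc d w w' \<noteq> 0"
  then obtain u c v z where "w = u @ [c] @ z" "w' = u @ v @ z" "d c v \<noteq> 0"
    by (rule word_diff_nonzeroE)
  moreover from this have "wdeg degc v = degc c + 1" using d_homog by (auto simp: homog_def)
  ultimately show "wdeg degc w' = wdeg degc w + 1" by simp
qed

lemma filtered_left_diff: "filtered_mat tlen tlen (left_diff degc d)"
  unfolding tlen_eq_prod_wt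
  by (intro filtered_kron filtered_word_diff filtered_basis_vec)

lemma filtered_right_diff: "filtered_mat tlen tlen (right_diff degc degm d)"
  unfolding tlen_eq_prod_wt
  by (intro filtered_kron filtered_word_diff filtered_sign_mat)

lemma filtered_deriv_mat:
  assumes "\<And>m. adm_BM (dM m)"
  shows "filtered_mat tlen tlen (deriv_mat degc degm d dM)"
  unfolding deriv_mat_def
  by (intro filtered_mat_add filtered_left_diff filtered_bimod_mat filtered_right_diff assms)

lemma lin_ext_deriv_mat:
  assumes "adm_BM x" "\<And>m. adm_BM (dM m)"
  shows "lin_ext (deriv_mat degc degm d dM) x
    = lin_ext (left_diff degc d) x + bimod_ext degc 1 dM x + lin_ext (right_diff degc degm d) x"
proof -
  have x: "locally_finite tlen x" using assms(1) by (simp add: adm_BM_iff_locally_finite)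
  note dM = filtered_bimod_mat [of dM degc 1, OF assms(2)]
  note filtered = filtered_mat_add [OF filtered_left_diff dM]
  show ?thesis
    unfolding deriv_mat_def lin_ext_add_mat [OF x filtered filtered_right_diff]
      lin_ext_add_mat [OF x filtered_left_diff dM] ..
qed

lemma DMext_eq_lin_ext:
  assumes "adm_BM x" "\<And>m. adm_BM (dM m)"
  shows "DMext degc degm d dM x = lin_ext (deriv_mat degc degm d dM) x"
proof (rule ext, clarify)
  fix u m v
  have x: "locally_finite tlen x" using assms(1) by (simp add: adm_BM_iff_locally_finite)
  have "locally_finite length (\<lambda>w. x (w, m, v))" "locally_finite length (\<lambda>w. x (u, m, w))"
    by (rule locally_finite_slice [OF x, of _ _ "length v"]; simp add: inj_def)
      (rule locally_finite_slice [OF x, of _ _ "length u"]; simp add: inj_def)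
  then show "DMext degc degm d dM x (u, m, v) = lin_ext (deriv_mat degc degm d dM) x (u, m, v)"
    by (simp add: DMext_eq_sum_parts lin_ext_deriv_mat assms lin_ext_kron_basis_vec
        lin_ext_kron_sign_mat
        Dext_eq_lin_ext bimod_ext_apply)
qed

lemma left_diff_diag_gen_commute:
  assumes "\<And>m. fin_supp (h m)"
  shows "lin_ext (left_diff degc d) \<circ> bimod_mat degc e (diag_gen h)
    = (\<lambda>t. ksign e *\<^sub>f (bimod_ext degc e (diag_gen h) \<circ> (left_diff degc d)) t)"
proof -
  let ?s = "sign_mat (\<lambda>u. e * wdeg degc u) :: 'c list \<Rightarrow> 'c list \<Rightarrow> 'k"
  note h = filtered_kron [OF filtered_fin_supp [OF assms] filtered_basis_vec]
  have "ksign (e * wdeg degc w') = (ksign e :: 'k) * ksign (e * wdeg degc w)"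
    if "word_diff degc d w w' \<noteq> 0" for w w'
  proof -
    have "wdeg degc w' = wdeg degc w + 1" using homog_word_diff that by (simp add: homog_def)
    then show ?thesis by (simp add: ksign_add distrib_left)
  qed
  then have "lin_ext ?s \<circ> word_diff degc d = (\<lambda>w. ksign e *\<^sub>f (lin_ext (word_diff degc d) \<circ> ?s) w)"
    by (rule sign_mat_commute)
  then have sign: "(\<lambda>w. ksign e *\<^sub>f (lin_ext ?s \<circ> word_diff degc d) w)
      = lin_ext (word_diff degc d) \<circ> ?s"
    by (simp add: fun_eq_iff)
  have "lin_ext (left_diff degc d) \<circ> (?s \<otimes> h \<otimes> basis_vec)
      = (lin_ext (word_diff degc d) \<circ> ?s) \<otimes> h \<otimes> basis_vec"
    by (simp add: kron_comp [OF filtered_sign_mat filtered_word_diff h filtered_basis_vec])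
  also have "\<dots> = (\<lambda>t. ksign e *\<^sub>f ((lin_ext ?s \<circ> word_diff degc d) \<otimes> h \<otimes> basis_vec) t)"
    by (simp only: kron_scale_left flip: sign)
  also have "(lin_ext ?s \<circ> word_diff degc d) \<otimes> h \<otimes> basis_vec
      = lin_ext (?s \<otimes> h \<otimes> basis_vec) \<circ> (left_diff degc d)"
    by (simp add: kron_comp [OF filtered_word_diff filtered_sign_mat filtered_basis_vec h])
  finally show ?thesis by (simp only: bimod_mat_diag_gen kron_basis_vec)
qed

lemma right_diff_diag_gen_commute:
  assumes "\<And>m. fin_supp (h m)" "\<And>m. homog degn (degm m + e) (h m)"
  shows "lin_ext (right_diff degc degn d) \<circ> bimod_mat degc e (diag_gen h)
    = (\<lambda>t. ksign e *\<^sub>f (bimod_ext degc e (diag_gen h)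
        \<circ> (right_diff degc degm d)) t)"
proof -
  let ?s = "sign_mat (\<lambda>u. e * wdeg degc u) :: 'c list \<Rightarrow> 'c list \<Rightarrow> 'k"
  let ?w = "sign_mat (wdeg degc) :: 'c list \<Rightarrow> 'c list \<Rightarrow> 'k"
  note h = filtered_fin_supp [OF assms(1)]
  have "ksign (degn n) = (ksign e :: 'k) * ksign (degm m)" if "h m n \<noteq> 0" for m n
    using assms(2) that by (simp add: homog_def ksign_add)
  then have sign: "lin_ext (sign_mat degn) \<circ> h = (\<lambda>m. ksign e *\<^sub>f (lin_ext h \<circ> sign_mat degm) m)"
    by (rule sign_mat_commute)
  have words: "lin_ext ?w \<circ> ?s = lin_ext ?s \<circ> ?w"
    by (simp add: sign_mat_comp add.commute)
  have "lin_ext (?w \<otimes> sign_mat degn \<otimes> word_diff degc d) \<circ> (?s \<otimes> h \<otimes> basis_vec)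
      = (lin_ext ?w \<circ> ?s) \<otimes> (lin_ext (sign_mat degn) \<circ> h) \<otimes> word_diff degc d"
    by (simp add: kron_comp [OF filtered_sign_mat filtered_sign_mat
          filtered_kron [OF h filtered_basis_vec]
          filtered_kron [OF filtered_sign_mat filtered_word_diff]]
        kron_comp [OF h filtered_sign_mat filtered_basis_vec filtered_word_diff])
  also have "\<dots> = (\<lambda>t. ksign e *\<^sub>f ((lin_ext ?s \<circ> ?w) \<otimes> (lin_ext h \<circ> sign_mat degm)
      \<otimes> word_diff degc d) t)"
    by (simp only: sign words kron_scale_left kron_scale_right)
  also have "(lin_ext ?s \<circ> ?w) \<otimes> (lin_ext h \<circ> sign_mat degm) \<otimes> word_diff degc d
      = lin_ext (?s \<otimes> h \<otimes> basis_vec) \<circ> (?w \<otimes> sign_mat degm \<otimes> word_diff degc d)"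
    by (simp add: kron_comp [OF filtered_sign_mat filtered_sign_mat
          filtered_kron [OF filtered_sign_mat filtered_word_diff]
          filtered_kron [OF h filtered_basis_vec]]
        kron_comp [OF filtered_sign_mat h filtered_word_diff filtered_basis_vec])
  finally show ?thesis by (simp only: bimod_mat_diag_gen kron_basis_vec)
qed

lemma DMext_bimod_ext_diag_gen:
  assumes x: "adm_BM x" and dM: "\<And>m. adm_BM (dM m)" and dN: "\<And>n. adm_BM (dN n)"
    and h: "\<And>m. fin_supp (h m)" "\<And>m. homog degn (degm m + e) (h m)"
  shows "DMext degc degn d dN (bimod_ext degc e (diag_gen h) x)
    = ksign e *\<^sub>f bimod_ext degc e (diag_gen h) (DMext degc degm d dM x)
    + (bimod_ext degc (e + 1) (bimod_ext degc 1 dN \<circ> diag_gen h) x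
      - ksign e *\<^sub>f bimod_ext degc (1 + e) (bimod_ext degc e (diag_gen h) \<circ> dM) x)"
proof -
  let ?T = "bimod_ext degc e (diag_gen h)" and ?\<epsilon> = "ksign e :: 'k"
  let ?L = "left_diff degc d" and ?B = "\<lambda>dM. bimod_ext degc 1 dM"
    and ?R = "\<lambda>deg. right_diff degc deg d"
  note gen = adm_BM_diag_gen [OF h(1)]
  have T: "filtered_mat tlen tlen (bimod_mat degc e (diag_gen h))"
    by (rule filtered_bimod_mat) (rule gen)
  have x': "locally_finite tlen x" and Tx: "adm_BM (?T x)"
    using x adm_BM_bimod_ext [OF x gen] by (simp_all add: adm_BM_iff_locally_finite)
  have L: "lin_ext ?L (?T x) = ?\<epsilon> *\<^sub>f ?T (lin_ext ?L x)"
    using lin_ext_comp [OF x' T filtered_left_diff] lin_ext_comp [OF x' filtered_left_diff T]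
    by (simp only: left_diff_diag_gen_commute [OF h(1)] lin_ext_scale_mat)
  have R: "lin_ext (?R degn) (?T x) = ?\<epsilon> *\<^sub>f ?T (lin_ext (?R degm) x)"
    using lin_ext_comp [OF x' T filtered_right_diff] lin_ext_comp [OF x' filtered_right_diff T]
    by (simp only: right_diff_diag_gen_commute [OF h] lin_ext_scale_mat)
  have "DMext degc degn d dN (?T x)
      = ?\<epsilon> *\<^sub>f ?T (lin_ext ?L x) + ?B dN (?T x) + ?\<epsilon> *\<^sub>f ?T (lin_ext (?R degm) x)"
    by (simp only: DMext_eq_lin_ext [OF Tx dN] lin_ext_deriv_mat [OF Tx dN] L R)
  moreover have "?T (DMext degc degm d dM x)
      = ?T (lin_ext ?L x) + ?T (?B dM x) + ?T (lin_ext (?R degm) x)"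
    unfolding DMext_eq_lin_ext [OF x dM] lin_ext_deriv_mat [OF x dM]
    using locally_finite_lin_ext [OF x' filtered_left_diff]
      locally_finite_lin_ext [OF x' filtered_right_diff]
      locally_finite_lin_ext [OF x' filtered_bimod_mat [of dM degc 1, OF dM]]
    by (simp only: lin_ext_add [OF _ _ T] locally_finite_add)
  ultimately show ?thesis
    unfolding bimod_ext_comp [OF x gen dN, symmetric] bimod_ext_comp [OF x dM gen, symmetric]
    by (simp add: fun_space.scale_right_distrib)
qed

end

section \<open>Unipotent matrices\<close>

definition unipotent_mat :: "('a \<Rightarrow> nat) \<Rightarrow> ('a \<Rightarrow> 'a \<Rightarrow> 'k::field) \<Rightarrow> bool"
  where "unipotent_mat wt U \<longleftrightarrow> filtered_mat wt wt U \<and> (\<forall>a b. wt b \<le> wt a \<longrightarrow> U a b = basis_vec a b)"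

lemma filtered_unipotent_mat: "unipotent_mat wt U \<Longrightarrow> filtered_mat wt wt U"
  by (simp add: unipotent_mat_def)

lemma unipotent_lin_ext_apply:
  assumes U: "unipotent_mat wt U" and x: "\<And>a. wt a < wt b \<Longrightarrow> x a = 0"
  shows "lin_ext U x b = x b"
proof -
  have "x a * U a b = x a * basis_vec a b" for a
    using U x [of a] by (cases "wt a < wt b") (auto simp: unipotent_mat_def)
  then have "lin_ext U x b = lin_ext basis_vec x b"
    unfolding lin_ext_apply by (rule Sum_any.cong)
  then show ?thesis by simp
qed

lemma unipotent_lin_ext_eq_zeroD:
  assumes U: "unipotent_mat wt U" and "lin_ext U x = 0"
  shows "x = 0"
proof
  fix b show "x b = 0 b"
  proof (induction "wt b" arbitrary: b rule: less_induct)
    case less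
    then have "lin_ext U x b = x b"
      by (intro unipotent_lin_ext_apply [OF U]) auto
    then show ?case using assms(2) by simp
  qed
qed

text \<open>The residuals of the iteration \<open>y \<mapsto> y + (z - U y)\<close> started at \<open>0\<close>.\<close>
definition residual :: "('a \<Rightarrow> 'a \<Rightarrow> 'k::field) \<Rightarrow> ('a \<Rightarrow> 'k) \<Rightarrow> nat \<Rightarrow> 'a \<Rightarrow> 'k"
  where "residual U z k = ((\<lambda>r. r - lin_ext U r) ^^ k) z"

lemma residual_0: "residual U z 0 = z"
  and residual_Suc: "residual U z (Suc k) = residual U z k - lin_ext U (residual U z k)"
  by (simp_all add: residual_def)

lemma residual_eq_zero:
  assumes "unipotent_mat wt U"
  shows "wt b < k \<Longrightarrow> residual U z k b = 0"
proof (induction k arbitrary: b)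
  case (Suc k)
  have "lin_ext U (residual U z k) b = residual U z k b"
    by (rule unipotent_lin_ext_apply [OF assms]) (use Suc in auto)
  then show ?case by (simp add: residual_Suc)
qed simp

lemma locally_finite_residual:
  assumes "filtered_mat wt wt U" "locally_finite wt z"
  shows "locally_finite wt (residual U z k)"
  by (induction k)
    (simp_all only: residual_0 residual_Suc assms locally_finite_diff
        locally_finite_lin_ext [OF _ assms(1)])

lemma homog_residual:
  assumes "\<And>a. homog deg (deg a) (U a)" "homog deg n z"
  shows "homog deg n (residual U z k)"
proof (induction k)
  case 0
  show ?case by (simp only: residual_0 assms(2))
next
  case (Suc k)
  have "homog deg (n + 0) (lin_ext U (residual U z k))"
    by (rule homog_lin_ext [OF Suc]) (simp add: assms(1))
  then show ?case unfolding residual_Suc add_0_right by (rule homog_diff [OF Suc])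
qed

lemma locally_finite_sum:
  fixes x :: "nat \<Rightarrow> 'a \<Rightarrow> 'k::field"
  assumes "\<And>k. locally_finite wt (x k)"
  shows "locally_finite wt (\<Sum>k<n. x k)"
  by (induction n)
    (simp_all only: lessThan_0 sum.empty sum.lessThan_Suc locally_finite_zero locally_finite_add assms)

lemma lin_ext_sum_residual:
  assumes U: "filtered_mat wt wt U" and z: "locally_finite wt z"
  shows "lin_ext U (\<Sum>k<n. residual U z k) = z - residual U z n"
proof (induction n)
  case 0
  show ?case by (simp only: lessThan_0 sum.empty residual_0 lin_ext_zero diff_self)
next
  case (Suc n)
  note r = locally_finite_residual [OF U z]
  have "lin_ext U (\<Sum>k<Suc n. residual U z k) = z - residual U z n + lin_ext U (residual U z n)"
    by (simp only: sum.lessThan_Suc lin_ext_add [OF locally_finite_sum [OF r] r U] Suc)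
  then show ?case by (simp only: residual_Suc diff_diff_eq2 diff_add_eq)
qed

lemma unipotent_lin_ext_solvable:
  assumes U: "unipotent_mat wt U" and z: "locally_finite wt z"
  obtains y where "locally_finite wt y" "lin_ext U y = z"
    "\<And>deg n. \<lbrakk>\<And>a. homog deg (deg a) (U a); homog deg n z\<rbrakk> \<Longrightarrow> homog deg n y"
proof
  note filtered = filtered_unipotent_mat [OF U]
  define y where "y a = (\<Sum>k<Suc (wt a). residual U z k a)" for a
  have y_eq: "y a = (\<Sum>k<n. residual U z k) a" if "Suc (wt a) \<le> n" for n a
    using that
    by (induction n rule: dec_induct) (simp_all add: y_def sum_fun_apply residual_eq_zero [OF U])
  show "locally_finite wt y"
    unfolding locally_finite_def
  proof
    fix n
    have "{a. wt a \<le> n \<and> y a \<noteq> 0} = {a. wt a \<le> n \<and> (\<Sum>k<Suc n. residual U z k) a \<noteq> 0}"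
      using y_eq [of _ "Suc n"] by auto
    then show "finite {a. wt a \<le> n \<and> y a \<noteq> 0}"
      using locally_finite_sum [where n = "Suc n", OF locally_finite_residual [OF filtered z]]
      by (simp only: locally_finite_def)
  qed
  show "lin_ext U y = z"
  proof
    fix b
    have "lin_ext U y b = lin_ext U (\<Sum>k<Suc (wt b). residual U z k) b"
      by (rule lin_ext_agree [OF filtered], rule y_eq) simp
    then show "lin_ext U y b = z b"
      by (simp only: lin_ext_sum_residual [OF filtered z]) (simp add: residual_eq_zero [OF U])
  qed
  show "homog deg n y" if "\<And>a. homog deg (deg a) (U a)" "homog deg n z" for deg n
    using homog_residual [OF that] unfolding homog_def y_def
    by (metis (no_types, lifting) sum.neutral)
qed

section \<open>Contractions of cobimodules\<close>

definition bimod_gens :: "('c \<Rightarrow> int) \<Rightarrow> ('m \<Rightarrow> int) \<Rightarrow> ('n \<Rightarrow> int) \<Rightarrow> int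
    \<Rightarrow> ('m \<Rightarrow> 'c list \<times> 'n \<times> 'c list \<Rightarrow> 'k::field) \<Rightarrow> bool"
  where "bimod_gens degc degm degn e \<phi> \<longleftrightarrow>
    (\<forall>m. adm_BM (\<phi> m) \<and> homog (tdeg degc degn) (degm m + e) (\<phi> m))"

definition bimodule_map :: "('c \<Rightarrow> int) \<Rightarrow> ('m \<Rightarrow> int) \<Rightarrow> ('n \<Rightarrow> int) \<Rightarrow> int
    \<Rightarrow> (('c list \<times> 'm \<times> 'c list \<Rightarrow> 'k::field) \<Rightarrow> 'c list \<times> 'n \<times> 'c list \<Rightarrow> 'k) \<Rightarrow> bool"
  where "bimodule_map degc degm degn e T \<longleftrightarrow>
    (\<exists>\<phi>. bimod_gens degc degm degn e \<phi> \<and> (\<forall>x. adm_BM x \<longrightarrow> T x = bimod_ext degc e \<phi> x))"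

lemma bimod_gens_adm: "bimod_gens degc degm degn e \<phi> \<Longrightarrow> adm_BM (\<phi> m)"
  by (simp add: bimod_gens_def)

lemma bimod_gens_homog: "bimod_gens degc degm degn e \<phi> \<Longrightarrow> homog (tdeg degc degn) (degm m + e) (\<phi> m)"
  by (simp add: bimod_gens_def)

lemma bimod_gens_comp:
  assumes \<phi>: "bimod_gens degc degm degn e \<phi>" and \<psi>: "bimod_gens degc degn degp e' \<psi>"
  shows "bimod_gens degc degm degp (e + e') (bimod_ext degc e' \<psi> \<circ> \<phi>)"
  unfolding bimod_gens_def comp_apply add.assoc [symmetric]
  by (intro allI conjI adm_BM_bimod_ext homog_bimod_ext [of degc degn] bimod_gens_adm [OF \<phi>]
      bimod_gens_adm [OF \<psi>] bimod_gens_homog [OF \<phi>] bimod_gens_homog [OF \<psi>])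

lemma bimodule_map_bimod_ext:
  "bimod_gens degc degm degn e \<phi> \<Longrightarrow> bimodule_map degc degm degn e (bimod_ext degc e \<phi>)"
  by (auto simp: bimodule_map_def)

lemma bimodule_mapE:
  assumes "bimodule_map degc degm degn e T"
  obtains \<phi> where "bimod_gens degc degm degn e \<phi>" "\<And>x. adm_BM x \<Longrightarrow> T x = bimod_ext degc e \<phi> x"
proof -
  obtain \<phi> where gens: "bimod_gens degc degm degn e \<phi>"
    and T: "\<forall>x. adm_BM x \<longrightarrow> T x = bimod_ext degc e \<phi> x"
    using assms unfolding bimodule_map_def by (elim exE conjE)
  show thesis by (rule that [OF gens]) (simp add: T)
qed

lemma bimodule_map_adm:
  assumes "bimodule_map degc degm degn e T" "adm_BM x"
  shows "adm_BM (T x)"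
  using assms(1)
proof (rule bimodule_mapE)
  fix \<phi> assume \<phi>: "bimod_gens degc degm degn e \<phi>" and T: "\<And>x. adm_BM x \<Longrightarrow> T x = bimod_ext degc e \<phi> x"
  show "adm_BM (T x)"
    unfolding T [OF assms(2)] by (rule adm_BM_bimod_ext [OF assms(2) bimod_gens_adm [OF \<phi>]])
qed

lemma bimodule_map_homog:
  assumes "bimodule_map degc degm degn e T" "adm_BM x" "homog (tdeg degc degm) k x"
  shows "homog (tdeg degc degn) (k + e) (T x)"
  using assms(1)
proof (rule bimodule_mapE)
  fix \<phi> assume \<phi>: "bimod_gens degc degm degn e \<phi>" and T: "\<And>x. adm_BM x \<Longrightarrow> T x = bimod_ext degc e \<phi> x"
  show "homog (tdeg degc degn) (k + e) (T x)"
    unfolding T [OF assms(2)] by (rule homog_bimod_ext [OF assms(3) bimod_gens_homog [OF \<phi>]])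
qed

lemma bimodule_map_add:
  assumes "bimodule_map degc degm degn e T" "adm_BM x" "adm_BM y"
  shows "T (x + y) = T x + T y"
  using assms(1)
proof (rule bimodule_mapE)
  fix \<phi> assume \<phi>: "bimod_gens degc degm degn e \<phi>" and T: "\<And>x. adm_BM x \<Longrightarrow> T x = bimod_ext degc e \<phi> x"
  have "filtered_mat tlen tlen (bimod_mat degc e \<phi>)"
    by (rule filtered_bimod_mat) (rule bimod_gens_adm [OF \<phi>])
  then show "T (x + y) = T x + T y"
    unfolding T [OF assms(2)] T [OF assms(3)] T [OF adm_BM_add [OF assms(2,3)]]
    using assms(2,3) unfolding adm_BM_iff_locally_finite by (intro lin_ext_add)
qed

lemma bimodule_map_zero: "bimodule_map degc degm degn e T \<Longrightarrow> T 0 = 0"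
  by (erule bimodule_mapE) (simp add: adm_BM_iff_locally_finite)

lemma bimodule_map_uminus: "bimodule_map degc degm degn e T \<Longrightarrow> adm_BM x \<Longrightarrow> T (- x) = - T x"
  by (erule bimodule_mapE) (simp add: lin_ext_uminus adm_BM_uminus)

lemma bimodule_map_diff:
  assumes "bimodule_map degc degm degn e T" "adm_BM x" "adm_BM y"
  shows "T (x - y) = T x - T y"
proof -
  have "T (x + - y) = T x + T (- y)"
    by (rule bimodule_map_add [OF assms(1,2) adm_BM_uminus [OF assms(3)]])
  then show ?thesis by (simp only: bimodule_map_uminus [OF assms(1,3)] flip: diff_conv_add_uminus)
qed

lemma bimodule_map_comp:
  assumes "bimodule_map degc degm degn e T" "bimodule_map degc degn degp e' T'"
  shows "bimodule_map degc degm degp (e + e') (\<lambda>x. T' (T x))"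
proof -
  obtain \<phi> where \<phi>: "bimod_gens degc degm degn e \<phi>" and T: "\<And>x. adm_BM x \<Longrightarrow> T x = bimod_ext degc e \<phi> x"
    using assms(1) by (rule bimodule_mapE) blast
  obtain \<psi> where \<psi>: "bimod_gens degc degn degp e' \<psi>"
    and T': "\<And>x. adm_BM x \<Longrightarrow> T' x = bimod_ext degc e' \<psi> x"
    using assms(2) by (rule bimodule_mapE) blast
  note bimod_gens_comp [OF \<phi> \<psi>]
  moreover have "T' (T x) = bimod_ext degc (e + e') (bimod_ext degc e' \<psi> \<circ> \<phi>) x" if "adm_BM x" for x
    using T' [OF bimodule_map_adm [OF assms(1) that]]
    by (simp only: T [OF that] bimod_ext_comp [OF that bimod_gens_adm [OF \<phi>] bimod_gens_adm [OF \<psi>]])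
  ultimately show ?thesis by (auto simp: bimodule_map_def)
qed

lemma bimodule_map_scale:
  fixes degc :: "'c \<Rightarrow> int" and degm :: "'m \<Rightarrow> int"
  shows "bimodule_map degc degm degm 0 (scale_fun c)"
proof -
  let ?\<phi> = "\<lambda>m :: 'm. c *\<^sub>f basis_vec ([] :: 'c list, m, [] :: 'c list)"
  have "bimod_mat degc 0 ?\<phi> = (\<lambda>t. c *\<^sub>f basis_vec t)"
    by (auto simp: fun_eq_iff bimod_mat_simp wrap_scale)
  then have "bimod_ext degc 0 ?\<phi> x = c *\<^sub>f x" for x
    by (simp only: lin_ext_scale_mat lin_ext_identity)
  moreover have "homog (tdeg degc degm) (degm m + 0) (?\<phi> m)" for m
    using homog_scale [OF homog_basis_vec [of "tdeg degc degm" "([], m, [])"]] by simp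
  then have "bimod_gens degc degm degm 0 ?\<phi>"
    by (simp add: bimod_gens_def adm_BM_scale adm_BM_basis_vec)
  ultimately show ?thesis by (metis bimodule_map_def)
qed

lemma bimod_gens_diag_gen:
  "(\<And>m. fin_supp (h m)) \<Longrightarrow> (\<And>m. homog degn (degm m + e) (h m))
    \<Longrightarrow> bimod_gens degc degm degn e (diag_gen h)"
  by (simp add: bimod_gens_def adm_BM_diag_gen homog_diag_gen)

definition lowest :: "('m \<Rightarrow> 'c list \<times> 'n \<times> 'c list \<Rightarrow> 'k) \<Rightarrow> 'm \<Rightarrow> 'n \<Rightarrow> 'k"
  where "lowest \<phi> = (\<lambda>m n. \<phi> m ([], n, []))"

lemma bimod_mat_eq_basis_vec:
  fixes \<upsilon> :: "'m \<Rightarrow> 'c list \<times> 'm \<times> 'c list \<Rightarrow> 'k::field"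
  assumes "lowest \<upsilon> = basis_vec" "tlen s \<le> tlen t"
  shows "bimod_mat degc 0 \<upsilon> t s = basis_vec t s"
proof -
  obtain u m v where t: "t = (u, m, v)" by (cases t)
  show ?thesis
  proof (cases "\<exists>n. s = (u, n, v)")
    case True
    then obtain n where s: "s = (u, n, v)" ..
    have "bimod_mat degc 0 \<upsilon> t s = lowest \<upsilon> m n"
      using wrap_append [of u v "\<upsilon> m" "[]" n "[]"] by (simp add: s t bimod_mat_simp lowest_def)
    then show ?thesis by (simp add: s t assms(1) basis_vec_def)
  next
    case False
    have "wrap u v (\<upsilon> m) s = 0"
      by (rule wrap_eq_zeroI)
        (use False assms(2) in \<open>auto simp: t wrap_index_def split: prod.splits\<close>)
    with False show ?thesis by (simp add: t bimod_mat_simp basis_vec_def)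
  qed
qed

lemma unipotent_bimod_mat:
  assumes "bimod_gens degc deg deg 0 \<upsilon>" "lowest \<upsilon> = basis_vec"
  shows "unipotent_mat tlen (bimod_mat degc 0 \<upsilon>)"
  unfolding unipotent_mat_def
  by (intro conjI allI impI filtered_bimod_mat bimod_gens_adm [OF assms(1)] bimod_mat_eq_basis_vec
      assms(2))

lemma unipotent_bimod_ext_right_inverse:
  fixes \<upsilon> :: "'m \<Rightarrow> 'c list \<times> 'm \<times> 'c list \<Rightarrow> 'k::field"
  assumes \<upsilon>: "bimod_gens degc deg deg 0 \<upsilon>" "lowest \<upsilon> = basis_vec"
  obtains S where "bimodule_map degc deg deg 0 S" "\<And>x. adm_BM x \<Longrightarrow> bimod_ext degc 0 \<upsilon> (S x) = x"
proof -
  let ?U = "bimod_mat degc 0 \<upsilon>" and ?\<delta> = "\<lambda>m. basis_vec ([], m, []) :: 'c list \<times> 'm \<times> 'c list \<Rightarrow> 'k"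
  have hom: "homog (tdeg degc deg) (tdeg degc deg t) (?U t)" for t
    using homog_bimod_ext [OF homog_basis_vec [of "tdeg degc deg" t] bimod_gens_homog [OF \<upsilon>(1)]]
    by simp
  have "\<exists>y. adm_BM y \<and> lin_ext ?U y = ?\<delta> m \<and> homog (tdeg degc deg) (deg m) y" for m
  proof -
    obtain y where "locally_finite tlen y" "lin_ext ?U y = ?\<delta> m"
      and "\<And>deg' n. \<lbrakk>\<And>t. homog deg' (deg' t) (?U t); homog deg' n (?\<delta> m)\<rbrakk> \<Longrightarrow> homog deg' n y"
      using unipotent_lin_ext_solvable [OF unipotent_bimod_mat [OF \<upsilon>] locally_finite_basis_vec]
      by blast
    moreover have "homog (tdeg degc deg) (deg m) (?\<delta> m)"
      using homog_basis_vec [of "tdeg degc deg" "([], m, [])"] by simp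
    ultimately show ?thesis using hom by (auto simp: adm_BM_iff_locally_finite)
  qed
  then obtain \<sigma> where \<sigma>: "\<And>m. adm_BM (\<sigma> m)" "\<And>m. lin_ext ?U (\<sigma> m) = ?\<delta> m"
      "\<And>m. homog (tdeg degc deg) (deg m) (\<sigma> m)"
    by metis
  show thesis
  proof
    show "bimodule_map degc deg deg 0 (bimod_ext degc 0 \<sigma>)"
      using \<sigma> by (intro bimodule_map_bimod_ext) (simp add: bimod_gens_def)
    have "bimod_ext degc 0 \<upsilon> \<circ> \<sigma> = ?\<delta>"
      using \<sigma>(2) by auto
    then show "bimod_ext degc 0 \<upsilon> (bimod_ext degc 0 \<sigma> x) = x" if "adm_BM x" for x
      using bimod_ext_comp [OF that \<sigma>(1) bimod_gens_adm [OF \<upsilon>(1)], where e = 0 and e' = 0]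
      by (simp add: bimod_mat_basis_vec)
  qed
qed

lemma unipotent_bimod_ext_inverse:
  assumes \<upsilon>: "bimod_gens degc deg deg 0 \<upsilon>" "lowest \<upsilon> = basis_vec"
  obtains S where "bimodule_map degc deg deg 0 S"
    "\<And>x. adm_BM x \<Longrightarrow> bimod_ext degc 0 \<upsilon> (S x) = x" "\<And>x. adm_BM x \<Longrightarrow> S (bimod_ext degc 0 \<upsilon> x) = x"
proof -
  let ?U = "bimod_ext degc 0 \<upsilon>"
  have U: "bimodule_map degc deg deg 0 ?U"
    by (rule bimodule_map_bimod_ext [OF \<upsilon>(1)])
  obtain S where S: "bimodule_map degc deg deg 0 S" and US: "\<And>x. adm_BM x \<Longrightarrow> ?U (S x) = x"
    using unipotent_bimod_ext_right_inverse [OF \<upsilon>] by blast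
  have "S (?U x) = x" if x: "adm_BM x" for x
  proof -
    note Ux = bimodule_map_adm [OF U x]
    have "?U (S (?U x) - x) = 0"
      by (simp add: bimodule_map_diff [OF U bimodule_map_adm [OF S Ux] x] US [OF Ux])
    then have "S (?U x) - x = 0"
      by (rule unipotent_lin_ext_eq_zeroD [OF unipotent_bimod_mat [OF \<upsilon>]])
    then show ?thesis by simp
  qed
  with S US show thesis by (rule that)
qed

lemma bimod_ext_lowest:
  fixes \<phi> :: "'m \<Rightarrow> 'c list \<times> 'n \<times> 'c list \<Rightarrow> 'k::field"
  shows "bimod_ext degc e \<phi> x ([], n, []) = lin_ext (lowest \<phi>) (\<lambda>m. x ([], m, [])) n"
proof -
  have "t \<in> range (\<lambda>m. ([], m, []))" if "bimod_mat degc e \<phi> t ([], n, []) \<noteq> 0"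
      for t :: "'c list \<times> 'm \<times> 'c list"
  proof -
    obtain u m v where t: "t = (u, m, v)" by (cases t)
    with that have "wrap u v (\<phi> m) ([], n, []) \<noteq> 0" by (simp add: bimod_mat_simp)
    then obtain s where "([], n, []) = wrap_index u v s" by (rule wrap_nonzeroE)
    then show ?thesis by (cases s) (simp add: t)
  qed
  then show ?thesis
    unfolding lin_ext_apply lowest_def
    by (subst Sum_any_reindex_inj [of "\<lambda>m. ([], m, [])"]) (auto simp: inj_def)
qed

context uncurved_generators
begin

lemma DMext_lowest:
  assumes "adm_BM x"
  shows "DMext degc degm d dM x ([], m, []) = lin_ext (lowest dM) (\<lambda>m. x ([], m, [])) m"
  using bimod_ext_lowest [of degc 1 dM x m]
  by (simp add: DMext_eq_sum_parts Dext_def d_Nil bimod_ext_apply [OF assms])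

lemma DMext_add:
  assumes "adm_BM x" "adm_BM y" "\<And>m. adm_BM (dM m)"
  shows "DMext degc degm d dM (x + y) = DMext degc degm d dM x + DMext degc degm d dM y"
  unfolding DMext_eq_lin_ext [OF assms(1,3)] DMext_eq_lin_ext [OF assms(2,3)]
    DMext_eq_lin_ext [OF adm_BM_add [OF assms(1,2)] assms(3)]
  using assms(1,2) unfolding adm_BM_iff_locally_finite
  by (rule lin_ext_add) (rule filtered_deriv_mat [OF assms(3)])

lemma DMext_uminus:
  assumes "adm_BM x" "\<And>m. adm_BM (dM m)"
  shows "DMext degc degm d dM (- x) = - DMext degc degm d dM x"
  unfolding DMext_eq_lin_ext [OF assms] DMext_eq_lin_ext [OF adm_BM_uminus [OF assms(1)] assms(2)]
  by (rule lin_ext_uminus)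

lemma adm_BM_DMext:
  assumes "adm_BM x" "\<And>m. adm_BM (dM m)"
  shows "adm_BM (DMext degc degm d dM x)"
  unfolding DMext_eq_lin_ext [OF assms]
  using assms(1) filtered_deriv_mat [OF assms(2)] unfolding adm_BM_iff_locally_finite
  by (rule locally_finite_lin_ext)

lemma DMext_diag_gen_anticommutator:
  fixes deg :: "'m \<Rightarrow> int"
  defines "T h \<equiv> bimod_ext degc (- 1) (diag_gen h)"
  assumes dK: "bimod_gens degc deg deg 1 dK"
    and h: "\<And>a. fin_supp (h a)" "\<And>a. homog deg (deg a + - 1) (h a)"
    and contr: "\<And>a. lin_ext (lowest dK) (h a) + lin_ext h (lowest dK a) = basis_vec a"
  obtains \<upsilon> where "bimod_gens degc deg deg 0 \<upsilon>" "lowest \<upsilon> = basis_vec"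
    "\<And>x. adm_BM x \<Longrightarrow> DMext degc deg d dK (T h x) + T h (DMext degc deg d dK x) = bimod_ext degc 0 \<upsilon> x"
proof
  note dK_adm = bimod_gens_adm [OF dK]
  have h_gens: "bimod_gens degc deg deg (- 1) (diag_gen h)"
    by (rule bimod_gens_diag_gen [OF h])
  define \<upsilon>\<^sub>1 where "\<upsilon>\<^sub>1 = bimod_ext degc 1 dK \<circ> diag_gen h"
  define \<upsilon>\<^sub>2 where "\<upsilon>\<^sub>2 = T h \<circ> dK"
  have gens: "bimod_gens degc deg deg 0 \<upsilon>\<^sub>1" "bimod_gens degc deg deg 0 \<upsilon>\<^sub>2"
    using bimod_gens_comp [OF h_gens dK] bimod_gens_comp [OF dK h_gens]
    by (simp_all add: \<upsilon>\<^sub>1_def \<upsilon>\<^sub>2_def T_def)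
  then show "bimod_gens degc deg deg 0 (\<upsilon>\<^sub>1 + \<upsilon>\<^sub>2)"
    by (simp add: bimod_gens_def adm_BM_add homog_add)
  show "lowest (\<upsilon>\<^sub>1 + \<upsilon>\<^sub>2) = basis_vec"
  proof (rule ext, rule ext)
    fix a b
    have "lowest (\<upsilon>\<^sub>1 + \<upsilon>\<^sub>2) a b = (lin_ext (lowest dK) (h a) + lin_ext h (lowest dK a)) b"
      by (simp add: \<upsilon>\<^sub>1_def \<upsilon>\<^sub>2_def T_def lowest_def [of "_ + _"] bimod_ext_lowest)
        (simp add: lowest_def diag_gen_apply)
    then show "lowest (\<upsilon>\<^sub>1 + \<upsilon>\<^sub>2) a b = basis_vec a b" by (simp only: contr)
  qed
  fix x :: "'c list \<times> 'm \<times> 'c list \<Rightarrow> 'k" assume x: "adm_BM x"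
  show "DMext degc deg d dK (T h x) + T h (DMext degc deg d dK x) = bimod_ext degc 0 (\<upsilon>\<^sub>1 + \<upsilon>\<^sub>2) x"
    using DMext_bimod_ext_diag_gen [where dM = dK and dN = dK and h = h and degm = deg,
        OF x dK_adm dK_adm h]
    by (simp add: bimod_ext_add_gens [OF x] bimod_gens_adm [OF gens(1)] bimod_gens_adm [OF gens(2)]
        flip: T_def \<upsilon>\<^sub>1_def \<upsilon>\<^sub>2_def)
qed

definition contracting_homotopy :: "('m \<Rightarrow> int) \<Rightarrow> ('m \<Rightarrow> 'c list \<times> 'm \<times> 'c list \<Rightarrow> 'k)
    \<Rightarrow> (('c list \<times> 'm \<times> 'c list \<Rightarrow> 'k) \<Rightarrow> 'c list \<times> 'm \<times> 'c list \<Rightarrow> 'k) \<Rightarrow> bool"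
  where "contracting_homotopy degm dM H \<longleftrightarrow> bimodule_map degc degm degm (- 1) H
    \<and> (\<forall>x. adm_BM x \<longrightarrow> DMext degc degm d dM (H x) + H (DMext degc degm d dM x) = x)"

text \<open>The graded commutator \<open>U = D T + T D\<close> of the diagonal map \<open>T\<close> commutes with \<open>D\<close>, hence so
  does its inverse \<open>S\<close>, and \<open>D (T S) + (T S) D = U S = 1\<close>.\<close>
lemma cobimod_contraction:
  fixes deg :: "'m \<Rightarrow> int"
  assumes K: "ainf_cobimod degc deg d dK"
    and h: "\<And>a. fin_supp (h a)" "\<And>a. homog deg (deg a + - 1) (h a)"
    and contr: "\<And>a. lin_ext (lowest dK) (h a) + lin_ext h (lowest dK a) = basis_vec a"
  obtains H where "contracting_homotopy deg dK H"
proof -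
  let ?D = "DMext degc deg d dK" and ?T = "bimod_ext degc (- 1) (diag_gen h)"
  have dK: "bimod_gens degc deg deg 1 dK" and DD: "\<And>x. adm_BM x \<Longrightarrow> ?D (?D x) = 0"
    using K by (simp_all add: ainf_cobimod_def bimod_gens_def zero_fun_def)
  note D_adm = adm_BM_DMext [OF _ bimod_gens_adm [OF dK]]
    and D_add = DMext_add [OF _ _ bimod_gens_adm [OF dK]]
  have T: "bimodule_map degc deg deg (- 1) ?T"
    by (rule bimodule_map_bimod_ext [OF bimod_gens_diag_gen [OF h]])
  obtain \<upsilon> where \<upsilon>: "bimod_gens degc deg deg 0 \<upsilon>" "lowest \<upsilon> = basis_vec"
    and comm: "\<And>x. adm_BM x \<Longrightarrow> ?D (?T x) + ?T (?D x) = bimod_ext degc 0 \<upsilon> x"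
    using DMext_diag_gen_anticommutator [OF dK h contr] by blast
  let ?U = "bimod_ext degc 0 \<upsilon>"
  have UD: "?U (?D x) = ?D (?U x)" if x: "adm_BM x" for x
    using x bimodule_map_adm [OF T]
    by (simp add: DD D_add D_adm bimodule_map_zero [OF T] flip: comm)
  obtain S where S: "bimodule_map degc deg deg 0 S"
    and US: "\<And>x. adm_BM x \<Longrightarrow> ?U (S x) = x" and SU: "\<And>x. adm_BM x \<Longrightarrow> S (?U x) = x"
    using unipotent_bimod_ext_inverse [OF \<upsilon>] by metis
  have SD: "S (?D x) = ?D (S x)" if x: "adm_BM x" for x
  proof -
    note Sx = bimodule_map_adm [OF S x]
    show ?thesis
      using arg_cong [OF UD [OF Sx], of S] by (simp only: US [OF x] SU [OF D_adm [OF Sx]])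
  qed
  have "contracting_homotopy deg dK (\<lambda>x. ?T (S x))"
    unfolding contracting_homotopy_def
  proof (intro conjI allI impI)
    show "bimodule_map degc deg deg (- 1) (\<lambda>x. ?T (S x))"
      using bimodule_map_comp [OF S T] by simp
    show "?D (?T (S x)) + ?T (S (?D x)) = x" if "adm_BM x" for x
      using comm [OF bimodule_map_adm [OF S that]] by (simp add: SD US that)
  qed
  then show thesis by (rule that)
qed

end

section \<open>Finitely supported complexes\<close>

abbreviation "linear_fun \<equiv> Vector_Spaces.linear scale_fun scale_fun"

lemma lin_ext_cong_support:
  assumes "\<And>a. x a \<noteq> 0 \<Longrightarrow> K a = L a"
  shows "lin_ext K x = lin_ext L x"
proof
  fix b
  have "x a * K a b = x a * L a b" for a
    using assms by (cases "x a = 0") simp_all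
  then show "lin_ext K x b = lin_ext L x b"
    unfolding lin_ext_apply by (rule Sum_any.cong)
qed

lemma lin_ext_eq_sum:
  assumes "fin_supp x"
  shows "lin_ext K x = (\<Sum>a | x a \<noteq> 0. x a *\<^sub>f K a)"
proof
  fix b
  show "lin_ext K x b = (\<Sum>a | x a \<noteq> 0. x a *\<^sub>f K a) b"
    unfolding lin_ext_apply sum_fun_apply scale_fun_apply
    by (rule Sum_any.expand_superset) (use assms in \<open>auto simp: fin_supp_def\<close>)
qed

lemma lin_ext_diff_mat: "fin_supp x \<Longrightarrow> lin_ext (K - L) x = lin_ext K x - lin_ext L x"
  by (simp add: lin_ext_eq_sum fun_space.scale_right_diff_distrib sum_subtractf)

lemma linear_fun_lin_ext:
  assumes "linear_fun T" "fin_supp x"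
  shows "T (lin_ext K x) = lin_ext (T \<circ> K) x"
proof -
  interpret T: Vector_Spaces.linear scale_fun scale_fun T by (rule assms(1))
  show ?thesis
    by (simp only: lin_ext_eq_sum [OF assms(2)] T.sum T.scale comp_apply)
qed

lemma exists_linear_section:
  fixes D :: "'a \<Rightarrow> 'b \<Rightarrow> 'k::field"
  assumes fin: "\<And>a. fin_supp (D a)"
  obtains g where "linear_fun g"
    "\<And>x. fin_supp x \<Longrightarrow> fin_supp (g (lin_ext D x))"
    "\<And>x. fin_supp x \<Longrightarrow> lin_ext D (g (lin_ext D x)) = lin_ext D x"
proof -
  obtain B where B: "B \<subseteq> range D" "fun_space.independent B" "range D \<subseteq> fun_space.span B"
    by (rule fun_space.maximal_independent_subset)
  obtain g where lin: "linear_fun g"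
    and g: "\<And>b. b \<in> B \<Longrightarrow> g b = basis_vec (inv D b)"
    using fun_space.linear_independent_extend [OF B(2), of "\<lambda>b. basis_vec (inv D b)"] by blast
  interpret g: Vector_Spaces.linear scale_fun scale_fun g by (rule lin)
  let ?S = "{v. fin_supp (g v) \<and> lin_ext D (g v) = v}"
  have "fun_space.subspace ?S"
    by (rule fun_space.subspaceI)
      (simp_all add: g.zero g.add g.scale fin_supp_zero fin_supp_add fin_supp_scale
        lin_ext_add_fin_supp fin lin_ext_scale)
  moreover have "B \<subseteq> ?S"
    using B(1) by (auto simp: g fin_supp_basis_vec f_inv_into_f)
  ultimately have span: "fun_space.span B \<subseteq> ?S"
    by (rule fun_space.span_minimal [rotated])
  have "lin_ext D x \<in> ?S" if "fin_supp x" for x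
    unfolding lin_ext_eq_sum [OF that]
    by (rule subsetD [OF span], intro fun_space.span_sum fun_space.span_scale subsetD [OF B(3)]
        rangeI)
  then show thesis by (intro that [OF lin]) auto
qed

definition deg_part :: "('a \<Rightarrow> int) \<Rightarrow> int \<Rightarrow> ('a \<Rightarrow> 'k::field) \<Rightarrow> 'a \<Rightarrow> 'k"
  where "deg_part deg n x = (\<lambda>a. if deg a = n then x a else 0)"

lemma fin_supp_deg_part: "fin_supp x \<Longrightarrow> fin_supp (deg_part deg n x)"
  unfolding fin_supp_def deg_part_def by (rule rev_finite_subset) auto

lemma homog_deg_part: "homog deg n (deg_part deg n x)"
  by (simp add: homog_def deg_part_def)

lemma deg_part_homog: "homog deg n x \<Longrightarrow> deg_part deg n x = x"
  by (auto simp: homog_def deg_part_def fun_eq_iff)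

lemma linear_deg_part: "linear_fun (deg_part deg n)"
  by unfold_locales (auto simp: deg_part_def fun_eq_iff)

lemma lin_ext_deg_part:
  assumes "\<And>a. homog deg (deg a + 1) (D a)"
  shows "lin_ext D (deg_part deg n x) = deg_part deg (n + 1) (lin_ext D x)"
proof
  fix b
  have "deg_part deg n x a * D a b = (if deg b = n + 1 then x a * D a b else 0)" for a
    using assms [of a] by (cases "D a b = 0") (auto simp: homog_def deg_part_def)
  then show "lin_ext D (deg_part deg n x) b = deg_part deg (n + 1) (lin_ext D x) b"
    unfolding lin_ext_apply deg_part_def by simp
qed

lemma exists_graded_section:
  fixes D :: "'a \<Rightarrow> 'a \<Rightarrow> 'k::field"
  assumes fin: "\<And>a. fin_supp (D a)" and hom: "\<And>a. homog deg (deg a + 1) (D a)"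
  obtains G where "\<And>n. linear_fun (G n)" "\<And>n x. homog deg n (G n x)"
    "\<And>n x. fin_supp x \<Longrightarrow> fin_supp (G n (lin_ext D x))"
    "\<And>n x. fin_supp x \<Longrightarrow> lin_ext D (G n (lin_ext D x)) = deg_part deg (n + 1) (lin_ext D x)"
proof -
  obtain g where g: "linear_fun g"
    "\<And>x. fin_supp x \<Longrightarrow> fin_supp (g (lin_ext D x))"
    "\<And>x. fin_supp x \<Longrightarrow> lin_ext D (g (lin_ext D x)) = lin_ext D x"
    using exists_linear_section [of D, OF fin] by metis
  show thesis
  proof
    show "linear_fun (deg_part deg n \<circ> g)" for n
      by (rule Vector_Spaces.linear_compose [OF g(1) linear_deg_part])
  qed (simp_all add: homog_deg_part fin_supp_deg_part g lin_ext_deg_part hom)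
qed

lemma lin_ext_section_defect:
  assumes G: "linear_fun G" and G': "linear_fun G'"
    and "fin_supp (D a)" "lin_ext D (D a) = 0"
    and h: "\<And>c. D a c \<noteq> 0 \<Longrightarrow> h c = G (basis_vec c - G' (D c))"
  shows "lin_ext h (D a) = G (D a)"
proof -
  have "lin_ext h (D a) = lin_ext (G \<circ> (basis_vec - (G' \<circ> D))) (D a)"
    by (rule lin_ext_cong_support) (simp add: h)
  also have "\<dots> = G (lin_ext (basis_vec - (G' \<circ> D)) (D a))"
    by (rule linear_fun_lin_ext [OF G assms(3), symmetric])
  also have "lin_ext (basis_vec - (G' \<circ> D)) (D a) = D a - G' (lin_ext D (D a))"
    by (simp only: lin_ext_diff_mat [OF assms(3)] lin_ext_identity
        linear_fun_lin_ext [OF G' assms(3)])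
  also have "\<dots> = D a"
    by (simp only: assms(4) module_hom.zero [OF module_hom_linearI [OF G']] diff_zero)
  finally show ?thesis .
qed

lemma diff_in_bdries_if_acyclic:
  fixes D :: "'a \<Rightarrow> 'a \<Rightarrow> 'k::field"
  assumes "\<And>a. fin_supp (D a)" "cycles fin_supp deg (lin_ext D) n \<subseteq> bdries fin_supp deg (lin_ext D) n"
    and "fin_supp x" "homog deg n x" "fin_supp y" "homog deg n y" "lin_ext D x = lin_ext D y"
  shows "x - y \<in> bdries fin_supp deg (lin_ext D) n"
proof -
  have "lin_ext D (x - y) = 0"
    using assms by (simp add: lin_ext_diff_fin_supp)
  then have "x - y \<in> cycles fin_supp deg (lin_ext D) n"
    using fin_supp_diff [of x y] homog_diff [of deg n x y] assms
    by (simp add: cycles_def zero_fun_def)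
  then show ?thesis using assms(2) by blast
qed

text \<open>With a linear section \<open>G\<close> of the differential onto its image, \<open>a \<mapsto> G (a - G (D a))\<close> is a
  contraction.\<close>
lemma acyclic_contraction:
  fixes D :: "'a \<Rightarrow> 'a \<Rightarrow> 'k::field"
  assumes fin: "\<And>a. fin_supp (D a)" and hom: "\<And>a. homog deg (deg a + 1) (D a)"
    and DD: "\<And>a. lin_ext D (D a) = 0"
    and acyclic: "\<And>n. cycles fin_supp deg (lin_ext D) n \<subseteq> bdries fin_supp deg (lin_ext D) n"
  obtains h where "\<And>a. fin_supp (h a)" "\<And>a. homog deg (deg a + - 1) (h a)"
    "\<And>a. lin_ext D (h a) + lin_ext h (D a) = basis_vec a"
proof -
  obtain G where lin: "\<And>n. linear_fun (G n)"
    and G_hom: "\<And>n x. homog deg n (G n x)"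
    and G_fin: "\<And>n x. fin_supp x \<Longrightarrow> fin_supp (G n (lin_ext D x))"
    and DG: "\<And>n x. fin_supp x \<Longrightarrow> lin_ext D (G n (lin_ext D x)) = deg_part deg (n + 1) (lin_ext D x)"
    using exists_graded_section [of D, OF fin hom] by metis
  define r where "r a = basis_vec a - G (deg a) (D a)" for a
  have r_hom: "homog deg (deg a) (r a)" for a
    unfolding r_def by (rule homog_diff [OF homog_basis_vec G_hom])
  have "r a \<in> bdries fin_supp deg (lin_ext D) (deg a)" for a
    unfolding r_def
    using G_fin [OF fin_supp_basis_vec, of "deg a" a] DG [OF fin_supp_basis_vec, of "deg a" a]
    by (intro diff_in_bdries_if_acyclic [of D] fin acyclic fin_supp_basis_vec homog_basis_vec G_hom)
      (simp_all add: deg_part_homog [OF hom])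
  then have r_boundary: "\<exists>y. fin_supp y \<and> r a = lin_ext D y" for a
    by (fastforce simp: bdries_def)
  show thesis
  proof
    fix a
    obtain y where y: "fin_supp y" "r a = lin_ext D y" using r_boundary by blast
    show "fin_supp (G (deg a - 1) (r a))" unfolding y(2) by (rule G_fin [OF y(1)])
    show "homog deg (deg a + - 1) (G (deg a - 1) (r a))" using G_hom by simp
    have "lin_ext D (G (deg a - 1) (r a)) = r a"
      using DG [OF y(1), of "deg a - 1"] deg_part_homog [OF r_hom, of a] by (simp add: y(2))
    moreover have "lin_ext (\<lambda>c. G (deg c - 1) (r c)) (D a) = G (deg a) (D a)"
    proof (rule lin_ext_section_defect [OF lin lin fin DD])
      fix c assume "D a c \<noteq> 0"
      then have "deg c = deg a + 1" using hom [of a] by (simp add: homog_def)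
      then show "G (deg c - 1) (r c) = G (deg a) (basis_vec c - G (deg a + 1) (D c))"
        by (simp add: r_def)
    qed
    ultimately show "lin_ext D (G (deg a - 1) (r a)) + lin_ext (\<lambda>c. G (deg c - 1) (r c)) (D a)
        = basis_vec a"
      by (simp add: r_def)
  qed
qed

definition cone_mat :: "('m \<Rightarrow> 'm \<Rightarrow> 'k::field) \<Rightarrow> ('n \<Rightarrow> 'n \<Rightarrow> 'k) \<Rightarrow> ('m \<Rightarrow> 'n \<Rightarrow> 'k)
    \<Rightarrow> 'm + 'n \<Rightarrow> 'm + 'n \<Rightarrow> 'k"
  where "cone_mat A B F = case_sum (\<lambda>m. case_sum (- A m) (F m)) (\<lambda>n. case_sum 0 (B n))"

definition cone_deg :: "('m \<Rightarrow> int) \<Rightarrow> ('n \<Rightarrow> int) \<Rightarrow> 'm + 'n \<Rightarrow> int"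
  where "cone_deg degm degn = case_sum (\<lambda>m. degm m - 1) degn"

lemma cone_deg_simps [simp]:
  "cone_deg degm degn (Inl m) = degm m - 1" "cone_deg degm degn (Inr n) = degn n"
  by (simp_all add: cone_deg_def)

lemma case_sum_eq_zero_iff: "case_sum x y = 0 \<longleftrightarrow> x = 0 \<and> y = (0 :: 'b \<Rightarrow> 'c::zero)"
  by (auto simp: fun_eq_iff split_sum_all)

lemma Collect_sum_type: "{a. P a} = {m. P (Inl m)} <+> {n. P (Inr n)}"
proof (rule set_eqI)
  show "a \<in> {a. P a} \<longleftrightarrow> a \<in> {m. P (Inl m)} <+> {n. P (Inr n)}" for a
    by (cases a) auto
qed

lemma fin_supp_case_sum_iff: "fin_supp (case_sum x y) \<longleftrightarrow> fin_supp x \<and> fin_supp y"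
  by (simp add: fin_supp_def Collect_sum_type)

lemma homog_cone_deg_iff:
  "homog (cone_deg degm degn) k (case_sum x y) \<longleftrightarrow> homog degm (k + 1) x \<and> homog degn k y"
  by (auto simp: homog_def split_sum_all)

lemma Sum_any_sum_type:
  fixes g :: "'a + 'b \<Rightarrow> 'c::comm_monoid_add"
  assumes "finite {m. g (Inl m) \<noteq> 0}" "finite {n. g (Inr n) \<noteq> 0}"
  shows "(\<Sum>a. g a) = (\<Sum>m. g (Inl m)) + (\<Sum>n. g (Inr n))"
  using assms by (simp add: Sum_any.expand_set Collect_sum_type sum.Plus)

lemma lin_ext_cone_mat:
  assumes "fin_supp x" "fin_supp y"
  shows "lin_ext (cone_mat A B F) (case_sum x y)
      = case_sum (- lin_ext A x) (lin_ext F x + lin_ext B y)"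
proof
  fix a
  have "(\<Sum>c. case_sum x y c * cone_mat A B F c a)
      = (\<Sum>m. x m * cone_mat A B F (Inl m) a) + (\<Sum>n. y n * cone_mat A B F (Inr n) a)"
    using assms by (subst Sum_any_sum_type) (simp_all add: fin_supp_def)
  then show "lin_ext (cone_mat A B F) (case_sum x y) a
      = case_sum (- lin_ext A x) (lin_ext F x + lin_ext B y) a"
    using lin_ext_scale_mat [of "-1" A x]
    by (cases a) (simp_all add: lin_ext_apply cone_mat_def fun_eq_iff)
qed

lemma cone_cycle_correction:
  fixes A :: "'m \<Rightarrow> 'm \<Rightarrow> 'k::field"
  assumes fin: "\<And>n. fin_supp (B n)" "\<And>m. fin_supp (F m)" and F_hom: "\<And>m. homog degn (degm m) (F m)"
    and chain: "\<And>x. fin_supp x \<Longrightarrow> lin_ext B (lin_ext F x) = lin_ext F (lin_ext A x)"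
    and iso: "induces_hom_iso fin_supp degm (lin_ext A) fin_supp degn (lin_ext B) (lin_ext F)"
    and x: "fin_supp x" "homog degm (k + 1) x" "lin_ext A x = 0"
    and y: "fin_supp y" "homog degn k y" "lin_ext F x + lin_ext B y = 0"
  obtains x\<^sub>1 x\<^sub>2 y\<^sub>1 where "fin_supp x\<^sub>1" "homog degm k x\<^sub>1" "lin_ext A x\<^sub>1 = x"
    "fin_supp x\<^sub>2" "homog degm k x\<^sub>2" "lin_ext A x\<^sub>2 = 0"
    "fin_supp y\<^sub>1" "homog degn (k - 1) y\<^sub>1" "lin_ext B y\<^sub>1 = lin_ext F x\<^sub>2 - (lin_ext F x\<^sub>1 + y)"
proof -
  have "x \<in> cycles fin_supp degm (lin_ext A) (k + 1)"
    using x by (simp add: cycles_def zero_fun_def)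
  moreover have "lin_ext F x = lin_ext B (- y)"
    using y(3) by (simp add: lin_ext_uminus eq_neg_iff_add_eq_0)
  then have "lin_ext F x \<in> bdries fin_supp degn (lin_ext B) (k + 1)"
    using y by (auto simp: bdries_def fin_supp_uminus homog_uminus)
  ultimately have "x \<in> bdries fin_supp degm (lin_ext A) (k + 1)"
    using iso by (simp add: induces_hom_iso_def)
  then obtain x\<^sub>1 where x\<^sub>1: "x = lin_ext A x\<^sub>1" "fin_supp x\<^sub>1" "homog degm k x\<^sub>1"
    by (auto simp: bdries_def)
  define w where "w = lin_ext F x\<^sub>1 + y"
  have Fx\<^sub>1: "fin_supp (lin_ext F x\<^sub>1)" "homog degn k (lin_ext F x\<^sub>1)"
    using fin_supp_lin_ext [OF x\<^sub>1(2) fin(2)] homog_lin_ext [OF x\<^sub>1(3), of degn 0] F_hom by simp_all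
  have "lin_ext B w = 0"
    unfolding w_def lin_ext_add_fin_supp [OF Fx\<^sub>1(1) y(1) fin(1)] chain [OF x\<^sub>1(2)]
    using y(3) by (simp add: x\<^sub>1(1))
  then have "w \<in> cycles fin_supp degn (lin_ext B) k"
    using Fx\<^sub>1 y by (simp add: cycles_def w_def fin_supp_add homog_add zero_fun_def)
  then obtain x\<^sub>2 where "x\<^sub>2 \<in> cycles fin_supp degm (lin_ext A) k"
    and "(\<lambda>n. lin_ext F x\<^sub>2 n - w n) \<in> bdries fin_supp degn (lin_ext B) k"
    using iso unfolding induces_hom_iso_def by blast
  then obtain y\<^sub>1 where "fin_supp x\<^sub>2" "homog degm k x\<^sub>2" "lin_ext A x\<^sub>2 = 0"
    and "fin_supp y\<^sub>1" "homog degn (k - 1) y\<^sub>1" "lin_ext B y\<^sub>1 = lin_ext F x\<^sub>2 - w"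
    by (auto simp: cycles_def bdries_def zero_fun_def fun_diff_def)
  with x\<^sub>1 show thesis using that by (simp only: w_def)
qed

lemma cone_acyclic:
  fixes A :: "'m \<Rightarrow> 'm \<Rightarrow> 'k::field"
  assumes fin: "\<And>m. fin_supp (A m)" "\<And>n. fin_supp (B n)" "\<And>m. fin_supp (F m)"
    and F_hom: "\<And>m. homog degn (degm m) (F m)"
    and chain: "\<And>x. fin_supp x \<Longrightarrow> lin_ext B (lin_ext F x) = lin_ext F (lin_ext A x)"
    and iso: "induces_hom_iso fin_supp degm (lin_ext A) fin_supp degn (lin_ext B) (lin_ext F)"
  shows "cycles fin_supp (cone_deg degm degn) (lin_ext (cone_mat A B F)) k
    \<subseteq> bdries fin_supp (cone_deg degm degn) (lin_ext (cone_mat A B F)) k"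
proof
  let ?C = "lin_ext (cone_mat A B F)"
  fix z assume "z \<in> cycles fin_supp (cone_deg degm degn) ?C k"
  moreover obtain x y where z: "z = case_sum x y"
    by (metis surjective_sum)
  ultimately have fin_xy: "fin_supp x" "fin_supp y"
    and hom_xy: "homog degm (k + 1) x" "homog degn k y"
    and "?C z = 0"
    by (simp_all add: cycles_def fin_supp_case_sum_iff homog_cone_deg_iff zero_fun_def)
  then have "lin_ext A x = 0" "lin_ext F x + lin_ext B y = 0"
    by (simp_all add: z lin_ext_cone_mat case_sum_eq_zero_iff)
  then obtain x\<^sub>1 x\<^sub>2 y\<^sub>1 where x\<^sub>1: "fin_supp x\<^sub>1" "homog degm k x\<^sub>1" "lin_ext A x\<^sub>1 = x"
    and x\<^sub>2: "fin_supp x\<^sub>2" "homog degm k x\<^sub>2" "lin_ext A x\<^sub>2 = 0"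
    and y\<^sub>1: "fin_supp y\<^sub>1" "homog degn (k - 1) y\<^sub>1"
        "lin_ext B y\<^sub>1 = lin_ext F x\<^sub>2 - (lin_ext F x\<^sub>1 + y)"
    using cone_cycle_correction [OF fin(2,3) F_hom chain iso fin_xy(1) hom_xy(1) _ fin_xy(2)
        hom_xy(2)]
    by metis
  define z' where "z' = case_sum (x\<^sub>2 - x\<^sub>1) (- y\<^sub>1)"
  have "?C z' = case_sum (- lin_ext A (x\<^sub>2 - x\<^sub>1)) (lin_ext F (x\<^sub>2 - x\<^sub>1) + lin_ext B (- y\<^sub>1))"
    unfolding z'_def
    by (rule lin_ext_cone_mat [OF fin_supp_diff [OF x\<^sub>2(1) x\<^sub>1(1)] fin_supp_uminus [OF y\<^sub>1(1)]])
  also have "\<dots> = z"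
    unfolding lin_ext_diff_fin_supp [OF x\<^sub>2(1) x\<^sub>1(1) fin(1)]
      lin_ext_diff_fin_supp [OF x\<^sub>2(1) x\<^sub>1(1) fin(3)]
    by (simp add: lin_ext_uminus x\<^sub>1(3) x\<^sub>2(3) y\<^sub>1(3) z)
  finally have "?C z' = z" .
  moreover have "fin_supp z'" "homog (cone_deg degm degn) (k - 1) z'"
    by (simp_all add: z'_def fin_supp_case_sum_iff homog_cone_deg_iff fin_supp_diff fin_supp_uminus
        homog_diff homog_uminus x\<^sub>1 x\<^sub>2 y\<^sub>1)
  ultimately show "z \<in> bdries fin_supp (cone_deg degm degn) ?C k"
    unfolding bdries_def by blast
qed

section \<open>The mapping cone of a cobimodule map\<close>

lemma diag_gen_basis_vec: "diag_gen (\<lambda>m. basis_vec (g m)) = (\<lambda>m. basis_vec ([], g m, []))"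
  by (auto simp: fun_eq_iff diag_gen_apply basis_vec_def)

lemma diag_gen_add: "diag_gen (h + h') = diag_gen h + diag_gen h'"
  by (auto simp: fun_eq_iff diag_gen_apply)

lemma diag_ext_identity: "bimod_ext degc 0 (diag_gen basis_vec) x = x"
  by (simp add: diag_gen_basis_vec [of "\<lambda>m. m", simplified] bimod_mat_basis_vec)

lemma diag_ext_zero: "bimod_ext degc e (diag_gen 0) x = 0"
  unfolding bimod_mat_diag_gen by (auto simp: fun_eq_iff lin_ext_apply kron_def)

lemma diag_ext_comp:
  assumes "\<And>m. fin_supp (h m)" "\<And>n. fin_supp (h' n)" "adm_BM x"
  shows "bimod_ext degc e' (diag_gen h') (bimod_ext degc e (diag_gen h) x)
    = bimod_ext degc (e + e') (diag_gen (lin_ext h' \<circ> h)) x"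
proof -
  note h = filtered_fin_supp [OF assms(1)] and h' = filtered_fin_supp [OF assms(2)]
  have x: "locally_finite tlen x" using assms(3) by (simp add: adm_BM_iff_locally_finite)
  have "bimod_ext degc e' (diag_gen h') \<circ> bimod_mat degc e (diag_gen h)
      = bimod_mat degc (e + e') (diag_gen (lin_ext h' \<circ> h))"
    unfolding bimod_mat_diag_gen
      kron_comp [OF filtered_sign_mat filtered_sign_mat filtered_kron [OF h filtered_basis_vec]
        filtered_kron [OF h' filtered_basis_vec]]
      kron_comp [OF h h' filtered_basis_vec filtered_basis_vec] sign_mat_comp
    by (simp add: distrib_right)
  then show ?thesis
    using lin_ext_comp [OF x
        filtered_bimod_mat [of "diag_gen h" degc e, OF adm_BM_diag_gen [OF assms(1)]]
        filtered_bimod_mat [of "diag_gen h'" degc e', OF adm_BM_diag_gen [OF assms(2)]]]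
    by (simp only:)
qed

definition inl_mat :: "'m \<Rightarrow> 'm + 'n \<Rightarrow> 'k::field" where "inl_mat m = basis_vec (Inl m)"
definition inr_mat :: "'n \<Rightarrow> 'm + 'n \<Rightarrow> 'k::field" where "inr_mat n = basis_vec (Inr n)"
definition projl_mat :: "'m + 'n \<Rightarrow> 'm \<Rightarrow> 'k::field" where "projl_mat = case_sum basis_vec 0"
definition projr_mat :: "'m + 'n \<Rightarrow> 'n \<Rightarrow> 'k::field" where "projr_mat = case_sum 0 basis_vec"

lemma fin_supp_biproduct [simp]:
  "fin_supp (inl_mat m)" "fin_supp (inr_mat n)" "fin_supp (projl_mat k)" "fin_supp (projr_mat k)"
  by (cases k; simp add: inl_mat_def inr_mat_def projl_mat_def projr_mat_def fin_supp_basis_vec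
      fin_supp_zero)+

lemma homog_biproduct:
  "homog (cone_deg degm degn) (degm m + - 1) (inl_mat m)"
  "homog (cone_deg degm degn) (degn n + 0) (inr_mat n)"
  "homog degm (cone_deg degm degn k + 1) (projl_mat k)"
  "homog degn (cone_deg degm degn k + 0) (projr_mat k)"
  using homog_basis_vec [of "cone_deg degm degn" "Inl m"]
    homog_basis_vec [of "cone_deg degm degn" "Inr n"]
  by (cases k; simp add: inl_mat_def inr_mat_def projl_mat_def projr_mat_def)+

lemma bimod_ext_inl_mat: "bimod_ext degc e \<phi> (diag_gen inl_mat m) = \<phi> (Inl m)"
  and bimod_ext_inr_mat: "bimod_ext degc e \<phi> (diag_gen inr_mat n) = \<phi> (Inr n)"
  by (simp_all add: diag_gen_basis_vec inl_mat_def [abs_def] inr_mat_def [abs_def])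

lemma lin_ext_inl_mat: "lin_ext inl_mat x = case_sum x 0"
  and lin_ext_inr_mat: "lin_ext inr_mat y = case_sum 0 y"
proof -
  have "lin_ext inl_mat x (Inl m) = x m" "lin_ext inr_mat y (Inr n) = y n" for m n
    by (simp_all add: inl_mat_def [abs_def] inr_mat_def [abs_def] lin_ext_basis_vec_image)
  moreover have "lin_ext inl_mat x (Inr n) = 0" "lin_ext inr_mat y (Inl m) = 0" for m n
    by (simp_all add: lin_ext_apply inl_mat_def inr_mat_def basis_vec_def)
  ultimately show "lin_ext inl_mat x = case_sum x 0" "lin_ext inr_mat y = case_sum 0 y"
    by (auto simp: fun_eq_iff split: sum.splits)
qed

lemma biproduct_comp:
  "lin_ext projl_mat \<circ> inl_mat = basis_vec" "lin_ext projr_mat \<circ> inr_mat = basis_vec"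
  "lin_ext projl_mat \<circ> inr_mat = 0" "lin_ext projr_mat \<circ> inl_mat = 0"
  "(lin_ext inl_mat \<circ> projl_mat) + (lin_ext inr_mat \<circ> projr_mat) = basis_vec"
proof -
  show "(lin_ext inl_mat \<circ> projl_mat) + (lin_ext inr_mat \<circ> projr_mat) = basis_vec"
  proof
    fix k show "((lin_ext inl_mat \<circ> projl_mat) + (lin_ext inr_mat \<circ> projr_mat)) k = basis_vec k"
      by (cases k) (simp_all add: inl_mat_def inr_mat_def projl_mat_def projr_mat_def)
  qed
qed (auto simp: fun_eq_iff inl_mat_def inr_mat_def projl_mat_def projr_mat_def)

lemma fin_supp_lowest: "bimod_gens degc degm degn e \<phi> \<Longrightarrow> fin_supp (lowest \<phi> m)"
  unfolding fin_supp_iff_locally_finite lowest_def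
  by (rule locally_finite_slice [of tlen _ _ _ 0])
    (auto simp: bimod_gens_def adm_BM_iff_locally_finite inj_def)

lemma homog_lowest: "bimod_gens degc degm degn e \<phi> \<Longrightarrow> homog degn (degm m + e) (lowest \<phi> m)"
  by (fastforce simp: bimod_gens_def homog_def lowest_def)

lemma lowest_diag_gen: "lowest (diag_gen h) = h"
  by (simp add: lowest_def diag_gen_apply fun_eq_iff)

lemma comp00_eq_lin_ext:
  assumes "fin_supp x"
  shows "comp00 \<phi> x = lin_ext (lowest \<phi>) x"
proof
  fix n show "comp00 \<phi> x n = lin_ext (lowest \<phi>) x n"
    unfolding comp00_def lin_ext_apply lowest_def
    by (rule Sum_any.expand_superset [symmetric]) (use assms in \<open>auto simp: fin_supp_def\<close>)
qed

lemma induces_hom_iso_comp00_iff: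
  "induces_hom_iso fin_supp degm (comp00 \<phi>) fin_supp degn (comp00 \<psi>) (comp00 f)
    \<longleftrightarrow> induces_hom_iso fin_supp degm (lin_ext (lowest \<phi>))
        fin_supp degn (lin_ext (lowest \<psi>)) (lin_ext (lowest f))"
proof -
  have cycles: "cycles fin_supp deg (comp00 \<phi>) n = cycles fin_supp deg (lin_ext (lowest \<phi>)) n"
    and bdries: "bdries fin_supp deg (comp00 \<phi>) n = bdries fin_supp deg (lin_ext (lowest \<phi>)) n"
        for deg \<phi> n
    by (auto simp: cycles_def bdries_def comp00_eq_lin_ext) (metis comp00_eq_lin_ext)
  have "comp00 f x = lin_ext (lowest f) x" if "x \<in> cycles fin_supp deg d n" for x deg d n
    using that by (simp add: cycles_def comp00_eq_lin_ext)
  then show ?thesis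
    unfolding induces_hom_iso_def cycles bdries by (simp cong: ball_cong bex_cong)
qed

locale cobimod_morphism = uncurved_generators degc d
  for degc :: "'c \<Rightarrow> int" and d :: "'c \<Rightarrow> 'c list \<Rightarrow> 'k::field" +
  fixes degm :: "'m \<Rightarrow> int" and degn :: "'n \<Rightarrow> int"
    and dM :: "'m \<Rightarrow> 'c list \<times> 'm \<times> 'c list \<Rightarrow> 'k"
    and dN :: "'n \<Rightarrow> 'c list \<times> 'n \<times> 'c list \<Rightarrow> 'k"
    and f :: "'m \<Rightarrow> 'c list \<times> 'n \<times> 'c list \<Rightarrow> 'k"
  assumes M: "ainf_cobimod degc degm d dM" and N: "ainf_cobimod degc degn d dN"
    and F: "cobimod_map degc degm degn d dM dN f"
begin

abbreviation "DM \<equiv> DMext degc degm d dM"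
abbreviation "DN \<equiv> DMext degc degn d dN"
abbreviation "degk \<equiv> cone_deg degm degn"
abbreviation iM :: "('c list \<times> 'm \<times> 'c list \<Rightarrow> 'k) \<Rightarrow> 'c list \<times> ('m + 'n) \<times> 'c list \<Rightarrow> 'k"
  where "iM \<equiv> bimod_ext degc (- 1) (diag_gen inl_mat)"
abbreviation iN :: "('c list \<times> 'n \<times> 'c list \<Rightarrow> 'k) \<Rightarrow> 'c list \<times> ('m + 'n) \<times> 'c list \<Rightarrow> 'k"
  where "iN \<equiv> bimod_ext degc 0 (diag_gen inr_mat)"
abbreviation pM :: "('c list \<times> ('m + 'n) \<times> 'c list \<Rightarrow> 'k) \<Rightarrow> 'c list \<times> 'm \<times> 'c list \<Rightarrow> 'k"
  where "pM \<equiv> bimod_ext degc 1 (diag_gen projl_mat)"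
abbreviation pN :: "('c list \<times> ('m + 'n) \<times> 'c list \<Rightarrow> 'k) \<Rightarrow> 'c list \<times> 'n \<times> 'c list \<Rightarrow> 'k"
  where "pN \<equiv> bimod_ext degc 0 (diag_gen projr_mat)"

definition dK :: "'m + 'n \<Rightarrow> 'c list \<times> ('m + 'n) \<times> 'c list \<Rightarrow> 'k"
  where "dK = case_sum (\<lambda>m. iN (f m) - iM (dM m)) (\<lambda>n. iN (dN n))"

abbreviation "DK \<equiv> DMext degc degk d dK"

lemma bimodule_map_iM: "bimodule_map degc degm degk (- 1) iM"
  and bimodule_map_iN: "bimodule_map degc degn degk 0 iN"
  and bimodule_map_pM: "bimodule_map degc degk degm 1 pM"
  and bimodule_map_pN: "bimodule_map degc degk degn 0 pN"
  by (intro bimodule_map_bimod_ext bimod_gens_diag_gen fin_supp_biproduct homog_biproduct)+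

lemmas iM_adm = bimodule_map_adm [OF bimodule_map_iM]
  and iN_adm = bimodule_map_adm [OF bimodule_map_iN]
  and pM_adm = bimodule_map_adm [OF bimodule_map_pM]
  and pN_adm = bimodule_map_adm [OF bimodule_map_pN]

lemma pM_iM: "adm_BM x \<Longrightarrow> pM (iM x) = x"
  and pN_iN: "adm_BM y \<Longrightarrow> pN (iN y) = y"
  and pM_iN: "adm_BM y \<Longrightarrow> pM (iN y) = 0"
  and pN_iM: "adm_BM x \<Longrightarrow> pN (iM x) = 0"
  by (simp_all add: diag_ext_comp biproduct_comp diag_ext_identity diag_ext_zero)

lemma biproduct_decomposition:
  assumes "adm_BM z"
  shows "iM (pM z) + iN (pN z) = z"
proof -
  let ?eM = "lin_ext inl_mat \<circ> projl_mat :: 'm + 'n \<Rightarrow> 'm + 'n \<Rightarrow> 'k"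
  let ?eN = "lin_ext inr_mat \<circ> projr_mat :: 'm + 'n \<Rightarrow> 'm + 'n \<Rightarrow> 'k"
  have fin: "fin_supp (?eM k)" "fin_supp (?eN k)" for k
    by (simp_all add: fin_supp_lin_ext)
  have "iM (pM z) + iN (pN z) = bimod_ext degc 0 (diag_gen ?eM) z + bimod_ext degc 0 (diag_gen ?eN) z"
    using assms by (simp add: diag_ext_comp)
  also have "\<dots> = bimod_ext degc 0 (diag_gen (?eM + ?eN)) z"
    unfolding diag_gen_add
    by (rule bimod_ext_add_gens [OF assms adm_BM_diag_gen adm_BM_diag_gen, symmetric]; rule fin)
  finally show ?thesis by (simp only: biproduct_comp diag_ext_identity)
qed

lemma bimod_gens_dM: "bimod_gens degc degm degm 1 dM"
  and bimod_gens_dN: "bimod_gens degc degn degn 1 dN"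
  and bimod_gens_f: "bimod_gens degc degm degn 0 f"
  using M N F by (simp_all add: ainf_cobimod_def cobimod_map_def bimod_gens_def)

lemmas dM_adm = bimod_gens_adm [OF bimod_gens_dM]
  and dN_adm = bimod_gens_adm [OF bimod_gens_dN]
  and f_adm = bimod_gens_adm [OF bimod_gens_f]

lemma bimodule_map_Fext: "bimodule_map degc degm degn 0 (Fext f)"
  using bimod_gens_f by (auto simp: bimodule_map_def Fext_eq_bimod_ext)

lemmas Fext_adm = bimodule_map_adm [OF bimodule_map_Fext]

lemma bimod_gens_dK: "bimod_gens degc degk degk 1 dK"
  unfolding bimod_gens_def
proof
  fix k
  note dM_homog = bimod_gens_homog [OF bimod_gens_dM]
    and dN_homog = bimod_gens_homog [OF bimod_gens_dN]
    and f_homog = bimod_gens_homog [OF bimod_gens_f]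
  show "adm_BM (dK k) \<and> homog (tdeg degc degk) (degk k + 1) (dK k)"
  proof (cases k)
    case (Inl m)
    have "homog (tdeg degc degk) (degm m + 1 + - 1) (iM (dM m))"
      by (rule bimodule_map_homog [OF bimodule_map_iM dM_adm dM_homog])
    moreover have "homog (tdeg degc degk) (degm m + 0 + 0) (iN (f m))"
      by (rule bimodule_map_homog [OF bimodule_map_iN f_adm f_homog])
    ultimately show ?thesis
      by (simp add: Inl dK_def homog_diff adm_BM_diff iM_adm [OF dM_adm] iN_adm [OF f_adm])
  next
    case (Inr n)
    then show ?thesis
      using bimodule_map_homog [OF bimodule_map_iN dN_adm dN_homog]
      by (simp add: dK_def iN_adm [OF dN_adm])
  qed
qed

lemmas dK_adm = bimod_gens_adm [OF bimod_gens_dK]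

lemma dK_Inl: "dK (Inl m) = iN (f m) - iM (dM m)" and dK_Inr: "dK (Inr n) = iN (dN n)"
  by (simp_all add: dK_def)

lemma DK_iM:
  assumes x: "adm_BM x"
  shows "DK (iM x) = iN (Fext f x) - iM (DM x)"
proof -
  let ?\<phi> = "bimod_ext degc 1 dK \<circ> diag_gen inl_mat" and ?\<psi> = "iM \<circ> dM"
  have gens: "?\<phi> + ?\<psi> = iN \<circ> f"
  proof
    fix m show "(?\<phi> + ?\<psi>) m = (iN \<circ> f) m"
      by (simp only: plus_fun_apply comp_apply bimod_ext_inl_mat dK_Inl diff_add_cancel)
  qed
  have "DK (iM x) = - iM (DM x) + (bimod_ext degc 0 ?\<phi> x + bimod_ext degc 0 ?\<psi> x)"
    using DMext_bimod_ext_diag_gen [where h = inl_mat and e = "- 1" and degm = degm and degn = degk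
        and dM = dM and dN = dK, OF x dM_adm dK_adm]
    by (simp add: homog_biproduct [simplified])
  also have "bimod_ext degc 0 ?\<phi> x + bimod_ext degc 0 ?\<psi> x = bimod_ext degc 0 (?\<phi> + ?\<psi>) x"
    using bimodule_map_adm [OF bimodule_map_bimod_ext [OF bimod_gens_dK]] iM_adm [OF dM_adm]
    by (simp add: bimod_ext_add_gens [OF x] adm_BM_diag_gen)
  also have "\<dots> = iN (Fext f x)"
    unfolding gens Fext_eq_bimod_ext [OF x, of f degc]
    by (simp add: bimod_ext_comp [OF x f_adm adm_BM_diag_gen])
  finally show ?thesis by (simp only: uminus_add_conv_diff)
qed

lemma DK_iN:
  assumes y: "adm_BM y"
  shows "DK (iN y) = iN (DN y)"
proof -
  have gens: "bimod_ext degc 1 dK \<circ> diag_gen inr_mat = iN \<circ> dN"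
    by (rule ext) (simp add: bimod_ext_inr_mat dK_Inr)
  show ?thesis
    using DMext_bimod_ext_diag_gen [where h = inr_mat and e = 0 and degm = degn and degn = degk
        and dM = dN and dN = dK, OF y dN_adm dK_adm]
    by (simp add: homog_biproduct [simplified] gens)
qed

lemma DM_adm: "adm_BM x \<Longrightarrow> adm_BM (DM x)" and DN_adm: "adm_BM y \<Longrightarrow> adm_BM (DN y)"
  and DK_adm: "adm_BM z \<Longrightarrow> adm_BM (DK z)"
  by (rule adm_BM_DMext; simp add: dM_adm dN_adm
      dK_adm)+

lemma DK_decomposition:
  assumes "adm_BM z"
  shows "DK z = iN (Fext f (pM z) + DN (pN z)) - iM (DM (pM z))"
proof -
  note x = pM_adm [OF assms] and y = pN_adm [OF assms]
  have "DK z = DK (iM (pM z) + iN (pN z))"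
    by (simp only: biproduct_decomposition [OF assms])
  also have "\<dots> = DK (iM (pM z)) + DK (iN (pN z))"
    by (rule DMext_add [OF iM_adm [OF x] iN_adm [OF y]
          dK_adm])
  finally show ?thesis
    by (simp add: DK_iM [OF x] DK_iN [OF y] DN_adm [OF y] Fext_adm [OF x]
        bimodule_map_add [OF bimodule_map_iN])
qed

lemma pM_DK: "adm_BM z \<Longrightarrow> pM (DK z) = - DM (pM z)"
  and pN_DK: "adm_BM z \<Longrightarrow> pN (DK z) = Fext f (pM z) + DN (pN z)"
proof -
  assume z: "adm_BM z"
  have Dx: "adm_BM (DM (pM z))" and y: "adm_BM (Fext f (pM z) + DN (pN z))"
    using z by (simp_all add: DM_adm DN_adm adm_BM_add pM_adm pN_adm
        Fext_adm)
  note inclusions = iN_adm [OF y] iM_adm [OF Dx]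
  show "pM (DK z) = - DM (pM z)"
    unfolding DK_decomposition [OF z] bimodule_map_diff [OF bimodule_map_pM inclusions]
    by (simp add: pM_iM [OF Dx] pM_iN [OF y])
  show "pN (DK z) = Fext f (pM z) + DN (pN z)"
    unfolding DK_decomposition [OF z] bimodule_map_diff [OF bimodule_map_pN inclusions]
    by (simp add: pN_iM [OF Dx] pN_iN [OF y])
qed

lemma DM_DM: "adm_BM x \<Longrightarrow> DM (DM x) = 0" and DN_DN: "adm_BM y \<Longrightarrow> DN (DN y) = 0"
  and DN_Fext: "adm_BM x \<Longrightarrow> DN (Fext f x) = Fext f (DM x)"
  using M N F by (simp_all add: ainf_cobimod_def cobimod_map_def zero_fun_def)

lemma DK_DK:
  assumes z: "adm_BM z"
  shows "DK (DK z) = 0"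
proof -
  note x = pM_adm [OF z] and y = pN_adm [OF z]
  have "DK (DK z) = iN (Fext f (- DM (pM z)) + DN (Fext f (pM z) + DN (pN z)))
      - iM (DM (- DM (pM z)))"
    by (simp only: DK_decomposition [OF DK_adm [OF z]] pM_DK [OF z] pN_DK [OF z])
  also have "DM (- DM (pM z)) = 0"
    by (simp add: DMext_uminus [OF DM_adm [OF x] dM_adm] DM_DM [OF x])
  also have "Fext f (- DM (pM z)) + DN (Fext f (pM z) + DN (pN z)) = 0"
    by (simp add: bimodule_map_uminus [OF bimodule_map_Fext DM_adm [OF x]] DN_DN [OF y] DN_Fext [OF x]
        DMext_add [OF Fext_adm [OF x] DN_adm [OF y] dN_adm])
  finally show ?thesis
    by (simp only: bimodule_map_zero [OF bimodule_map_iM] bimodule_map_zero [OF bimodule_map_iN]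
        diff_self)
qed

lemma ainf_cobimod_cone: "ainf_cobimod degc degk d dK"
  using bimod_gens_dK DK_DK by (simp add: ainf_cobimod_def bimod_gens_def zero_fun_def)

lemma lowest_dK: "lowest dK = cone_mat (lowest dM) (lowest dN) (lowest f)"
proof (rule ext, rule ext)
  fix k l show "lowest dK k l = cone_mat (lowest dM) (lowest dN) (lowest f) k l"
    by (cases k; cases l)
      (simp_all add: lowest_def [of dK] dK_Inl dK_Inr bimod_ext_lowest lowest_diag_gen lin_ext_inl_mat
        lin_ext_inr_mat cone_mat_def, simp_all add: lowest_def)
qed

lemma lowest_chain_map:
  assumes "fin_supp x"
  shows "lin_ext (lowest dN) (lin_ext (lowest f) x) = lin_ext (lowest f) (lin_ext (lowest dM) x)"
proof
  fix n
  define z :: "'c list \<times> 'm \<times> 'c list \<Rightarrow> 'k" where "z = diag_gen (\<lambda>_. x) ()"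
  have z: "adm_BM z" and z_lowest: "(\<lambda>m. z ([], m, [])) = x"
    using assms by (simp_all add: z_def adm_BM_diag_gen diag_gen_apply)
  have "(\<lambda>n. Fext f z ([], n, [])) = lin_ext (lowest f) x"
    by (simp add: Fext_eq_bimod_ext [OF z, of f degc] bimod_ext_lowest z_lowest)
  then have "lin_ext (lowest dN) (lin_ext (lowest f) x) n = DN (Fext f z) ([], n, [])"
    by (simp only: DMext_lowest [OF Fext_adm [OF z]])
  also have "\<dots> = Fext f (DM z) ([], n, [])"
    by (simp only: DN_Fext [OF z])
  also have "\<dots> = lin_ext (lowest f) (lin_ext (lowest dM) x) n"
    by (simp add: Fext_eq_bimod_ext [OF DM_adm [OF z], of f degc] bimod_ext_lowest
        DMext_lowest [OF z] z_lowest)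
  finally show "lin_ext (lowest dN) (lin_ext (lowest f) x) n
      = lin_ext (lowest f) (lin_ext (lowest dM) x) n" .
qed

lemma exists_cone_contraction:
  assumes "induces_hom_iso fin_supp degm (comp00 dM) fin_supp degn (comp00 dN) (comp00 f)"
  obtains H where "contracting_homotopy degk dK H"
proof -
  let ?A = "lowest dM" and ?B = "lowest dN" and ?F = "lowest f"
  have iso: "induces_hom_iso fin_supp degm (lin_ext ?A) fin_supp degn (lin_ext ?B) (lin_ext ?F)"
    using assms by (simp only: induces_hom_iso_comp00_iff)
  have square: "lin_ext (lowest dK) (lowest dK k) = 0" for k
  proof
    fix l
    let ?z = "basis_vec ([], k, []) :: 'c list \<times> ('m + 'n) \<times> 'c list \<Rightarrow> 'k"
    have "(\<lambda>m. ?z ([], m, [])) = basis_vec k"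
      by (auto simp: basis_vec_def)
    then have "(\<lambda>m. DK ?z ([], m, [])) = lowest dK k"
      by (simp add: DMext_lowest [OF adm_BM_basis_vec])
    then have "lin_ext (lowest dK) (lowest dK k) l = DK (DK ?z) ([], l, [])"
      by (simp only: DMext_lowest [OF DK_adm [OF adm_BM_basis_vec]])
    then show "lin_ext (lowest dK) (lowest dK k) l = 0 l"
      by (simp only: DK_DK [OF adm_BM_basis_vec] zero_fun_apply)
  qed
  have acyclic: "cycles fin_supp degk (lin_ext (lowest dK)) n
      \<subseteq> bdries fin_supp degk (lin_ext (lowest dK)) n" for n
    unfolding lowest_dK
    by (rule cone_acyclic [OF _ _ _ _ lowest_chain_map iso])
      (simp_all add: fin_supp_lowest [OF bimod_gens_dM] fin_supp_lowest [OF bimod_gens_dN]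
        fin_supp_lowest [OF bimod_gens_f] homog_lowest [OF bimod_gens_f, simplified])
  obtain h where "\<And>k. fin_supp (h k)" "\<And>k. homog degk (degk k + - 1) (h k)"
    "\<And>k. lin_ext (lowest dK) (h k) + lin_ext h (lowest dK k) = basis_vec k"
    using acyclic_contraction [OF fin_supp_lowest [OF bimod_gens_dK] homog_lowest [OF bimod_gens_dK]
        square acyclic]
    by metis
  then show thesis
    using cobimod_contraction [OF ainf_cobimod_cone] that by blast
qed

lemma pM_cone_contraction:
  assumes H: "contracting_homotopy degk dK H" and z: "adm_BM z"
  shows "DM (pM (H z)) = pM (H (DK z)) - pM z"
    and pN_cone_contraction: "Fext f (pM (H z)) + DN (pN (H z)) = pN z - pN (H (DK z))"
proof -
  have H_map: "bimodule_map degc degk degk (- 1) H" and "DK (H z) + H (DK z) = z"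
    using H z by (simp_all add: contracting_homotopy_def)
  then have DK_H: "DK (H z) = z - H (DK z)"
    by (simp add: eq_diff_eq)
  note Hz = bimodule_map_adm [OF H_map z] and HDz = bimodule_map_adm [OF H_map DK_adm [OF z]]
  show "DM (pM (H z)) = pM (H (DK z)) - pM z"
    using pM_DK [OF Hz] unfolding DK_H bimodule_map_diff [OF bimodule_map_pM z HDz]
    by (simp add: eq_neg_iff_add_eq_0 algebra_simps)
  show "Fext f (pM (H z)) + DN (pN (H z)) = pN z - pN (H (DK z))"
    using pN_DK [OF Hz] unfolding DK_H bimodule_map_diff [OF bimodule_map_pN z HDz] by simp
qed

lemma cone_contraction_homotopy_inverse:
  assumes contr: "contracting_homotopy degk dK H"
  defines "G \<equiv> \<lambda>y. pM (H (iN y))" and "hM \<equiv> \<lambda>x. pM (H (iM x))" and "hN \<equiv> \<lambda>y. - pN (H (iN y))"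
  shows "adm_BM y \<Longrightarrow> DM (G y) = G (DN y)"
    and "adm_BM x \<Longrightarrow> G (Fext f x) - x = DM (hM x) + hM (DM x)"
    and "adm_BM y \<Longrightarrow> Fext f (G y) - y = DN (hN y) + hN (DN y)"
proof -
  have H: "bimodule_map degc degk degk (- 1) H"
    using contr by (simp add: contracting_homotopy_def)
  note pM_H = bimodule_map_comp [OF H bimodule_map_pM]
    and pN_H = bimodule_map_comp [OF H bimodule_map_pN]
    and DM_pM_H = pM_cone_contraction [OF contr] and DN_pN_H = pN_cone_contraction [OF contr]
  show "DM (G y) = G (DN y)" if y: "adm_BM y"
    using DM_pM_H [OF iN_adm [OF y]] by (simp add: G_def DK_iN [OF y] pM_iN [OF y])
  show "G (Fext f x) - x = DM (hM x) + hM (DM x)" if x: "adm_BM x"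
  proof -
    have "G (Fext f x) - hM (DM x) = pM (H (DK (iM x)))"
      unfolding DK_iM [OF x] G_def hM_def
      by (rule bimodule_map_diff [OF pM_H iN_adm [OF Fext_adm [OF x]]
            iM_adm [OF DM_adm [OF x]], symmetric])
    then have "G (Fext f x) = pM (H (DK (iM x))) + hM (DM x)"
      by (simp only: diff_eq_eq)
    moreover have "DM (hM x) = pM (H (DK (iM x))) - x"
      unfolding hM_def DM_pM_H [OF iM_adm [OF x]] pM_iM [OF x] ..
    ultimately show ?thesis by (simp only: diff_add_eq)
  qed
  show "Fext f (G y) - y = DN (hN y) + hN (DN y)" if y: "adm_BM y"
    using DN_pN_H [OF iN_adm [OF y]]
    by (simp add: G_def hN_def DK_iN [OF y] pN_iN [OF y] algebra_simps
        DMext_uminus [OF bimodule_map_adm [OF pN_H iN_adm [OF y]] dN_adm])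
qed

lemma exists_homotopy_inverse:
  assumes "induces_hom_iso fin_supp degm (comp00 dM) fin_supp degn (comp00 dN) (comp00 f)"
  obtains g hM hN where "cobimod_map degc degn degm d dN dM g"
    "bimodule_map degc degm degm (- 1) hM" "bimodule_map degc degn degn (- 1) hN"
    "\<And>x. adm_BM x \<Longrightarrow> Fext g (Fext f x) - x = DM (hM x) + hM (DM x)"
    "\<And>y. adm_BM y \<Longrightarrow> Fext f (Fext g y) - y = DN (hN y) + hN (DN y)"
proof -
  obtain H where contr: "contracting_homotopy degk dK H"
    using assms by (rule exists_cone_contraction)
  then have H: "bimodule_map degc degk degk (- 1) H" by (simp add: contracting_homotopy_def)
  note homotopies = cone_contraction_homotopy_inverse [OF contr]
  have "bimodule_map degc degn degm 0 (\<lambda>y. pM (H (iN y)))"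
    using bimodule_map_comp [OF bimodule_map_iN bimodule_map_comp [OF H bimodule_map_pM]] by simp
  then obtain g where g: "bimod_gens degc degn degm 0 g"
    and G: "\<And>y. adm_BM y \<Longrightarrow> pM (H (iN y)) = bimod_ext degc 0 g y"
    by (rule bimodule_mapE) blast
  have Fext_g: "Fext g y = pM (H (iN y))" if "adm_BM y" for y
    by (simp only: Fext_eq_bimod_ext [OF that, of g degc] G [OF that])
  show thesis
  proof
    show "cobimod_map degc degn degm d dN dM g"
      using g homotopies(1) by (simp add: cobimod_map_def bimod_gens_def Fext_g DN_adm)
    show "bimodule_map degc degm degm (- 1) (\<lambda>x. pM (H (iM x)))"
      using bimodule_map_comp [OF bimodule_map_iM bimodule_map_comp [OF H bimodule_map_pM]] by simp
    show "bimodule_map degc degn degn (- 1) (\<lambda>y. - pN (H (iN y)))"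
      using bimodule_map_comp [OF
          bimodule_map_comp [OF bimodule_map_iN bimodule_map_comp [OF H bimodule_map_pN]]
          bimodule_map_scale [where c = "- 1"]]
      by simp
    show "Fext g (Fext f x) - x = DM (pM (H (iM x))) + pM (H (iM (DM x)))" if "adm_BM x" for x
      using homotopies(2) [OF that] by (simp only: Fext_g Fext_adm [OF that])
    show "Fext f (Fext g y) - y = DN (- pN (H (iN y))) + - pN (H (iN (DN y)))" if "adm_BM y" for y
      using homotopies(3) [OF that] by (simp only: Fext_g that)
  qed
qed

end

lemma hom_comp_id_homotopy:
  assumes "\<And>x. A x \<Longrightarrow> g (f x) - x = d (s x) + s (d x)" "s 0 = 0"
    and "\<And>x. A x \<Longrightarrow> A (s x)" "\<And>x n. A x \<Longrightarrow> homog deg n x \<Longrightarrow> homog deg (n - 1) (s x)"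
  shows "hom_comp_id A deg d g f"
  unfolding hom_comp_id_def
proof (intro allI ballI)
  fix n x assume "x \<in> cycles A deg d n"
  then have x: "A x" "homog deg n x" "d x = 0"
    by (auto simp: cycles_def zero_fun_def)
  have "g (f x) - x = d (s x)"
    using assms(1,2) x by simp
  then have "g (f x) - x \<in> bdries A deg d n"
    unfolding bdries_def using assms(3,4) x by blast
  then show "(\<lambda>a. g (f x) a - x a) \<in> bdries A deg d n"
    by (simp only: fun_diff_def)
qed

theorem mainTheorem2:
  fixes degc :: "'c \<Rightarrow> int" and degm :: "'m \<Rightarrow> int" and degn :: "'n \<Rightarrow> int"
    and d :: "'c \<Rightarrow> 'c list \<Rightarrow> 'k::field"
    and dM :: "'m \<Rightarrow> ('c list \<times> 'm \<times> 'c list) \<Rightarrow> 'k"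
    and dN :: "'n \<Rightarrow> ('c list \<times> 'n \<times> 'c list) \<Rightarrow> 'k"
    and f :: "'m \<Rightarrow> ('c list \<times> 'n \<times> 'c list) \<Rightarrow> 'k"
  assumes "ainf_coalg degc d"
    and "ainf_cobimod degc degm d dM"
    and "ainf_cobimod degc degn d dN"
    and "cobimod_map degc degm degn d dM dN f"
    and "induces_hom_iso fin_supp degm (comp00 dM) fin_supp degn (comp00 dN) (comp00 f)"
  shows "\<exists>g. cobimod_map degc degn degm d dN dM g \<and>
    hom_comp_id adm_BM (tdeg degc degm) (DMext degc degm d dM) (Fext g) (Fext f) \<and>
    hom_comp_id adm_BM (tdeg degc degn) (DMext degc degn d dN) (Fext f) (Fext g)"
proof -
  interpret cobimod_morphism degc d degm degn dM dN f
    using assms(1-4) by unfold_locales (simp_all add: ainf_coalg_def)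
  obtain g hM hN where g: "cobimod_map degc degn degm d dN dM g"
    and hM: "bimodule_map degc degm degm (- 1) hM" and hN: "bimodule_map degc degn degn (- 1) hN"
    and GF: "\<And>x. adm_BM x \<Longrightarrow> Fext g (Fext f x) - x = DM (hM x) + hM (DM x)"
    and FG: "\<And>y. adm_BM y \<Longrightarrow> Fext f (Fext g y) - y = DN (hN y) + hN (DN y)"
    using exists_homotopy_inverse [OF assms(5)] by metis
  have "hom_comp_id adm_BM (tdeg degc degm) DM (Fext g) (Fext f)"
    using GF bimodule_map_zero [OF hM] bimodule_map_adm [OF hM] bimodule_map_homog [OF hM]
    by (intro hom_comp_id_homotopy [where s = hM]) simp_all
  moreover have "hom_comp_id adm_BM (tdeg degc degn) DN (Fext f) (Fext g)"
    using FG bimodule_map_zero [OF hN] bimodule_map_adm [OF hN] bimodule_map_homog [OF hN]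
    by (intro hom_comp_id_homotopy [where s = hN]) simp_all
  ultimately show ?thesis using g by blast
qed

end
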